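(* Assume that $K$ is an infinite field of characteristic unequal to two. For every $N \ge 5$ there are infinitely many conjugacy classes of inclusion-wise maximal singular $N\times N$-matrix spaces over $K$.
   Context: A singular matrix space is a $K$-linear subspace $\mathcal{A}\subseteq K^{N\times N}$ consisting entirely of singular matrices. It is inclusion-wise maximal if it is not properly contained in another singular matrix space in $K^{N\times N}$. Two singular matrix spaces $\mathcal{A},\mathcal{A}'\subseteq K^{N\times N}$ are conjugate if $\mathcal{A}'=g\mathcal{A}h^{-1}$ for some $(g,h)\in \mathrm{GL}_N(K)\times \mathrm{GL}_N(K)$; conjugacy classes are the equivalence classes of this relation. *)

theory Defs
  imports "Jordan_Normal_Form.VS_Connect"
begin

definition singular_matrix_space :: "nat \<Rightarrow> 'k::field mat set \<Rightarrow> bool" where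
  "singular_matrix_space N \<A> \<longleftrightarrow>
     VectorSpace.subspace class_ring \<A> (module_mat TYPE('k) N N) \<and>
     (\<forall>A\<in>\<A>. \<not> invertible_mat A)"

definition maximal_singular_matrix_space :: "nat \<Rightarrow> 'k::field mat set \<Rightarrow> bool" where
  "maximal_singular_matrix_space N \<A> \<longleftrightarrow>
     singular_matrix_space N \<A> \<and>
     \<not> (\<exists>\<B>. singular_matrix_space N \<B> \<and> \<A> \<subset> \<B>)"

(* The mutually inverse h and h' express h' = h^{-1}; the library's mat_inverse is option-valued. *)
definition conjugate_matrix_spaces :: "nat \<Rightarrow> 'k::field mat set \<Rightarrow> 'k mat set \<Rightarrow> bool" where
  "conjugate_matrix_spaces N \<A> \<A>' \<longleftrightarrow>
     (\<exists>g\<in>carrier_mat N N. \<exists>h\<in>carrier_mat N N. \<exists>h'\<in>carrier_mat N N.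
        invertible_mat g \<and> inverts_mat h h' \<and> inverts_mat h' h \<and>
        \<A>' = (\<lambda>A. g * A * h') ` \<A>)"

definition conjugacy_rel :: "nat \<Rightarrow> ('k::field mat set \<times> 'k mat set) set" where
  "conjugacy_rel N = {(\<A>, \<A>'). singular_matrix_space N \<A> \<and> singular_matrix_space N \<A>' \<and>
     conjugate_matrix_spaces N \<A> \<A>'}"

lemma singular_matrix_space_iff:
  fixes \<A> :: "'k::field mat set"
  shows "singular_matrix_space N \<A> \<longleftrightarrow>
    \<A> \<subseteq> carrier_mat N N \<and> 0\<^sub>m N N \<in> \<A> \<and> (\<forall>A\<in>\<A>. \<forall>B\<in>\<A>. A + B \<in> \<A>) \<and>
    (\<forall>c. \<forall>A\<in>\<A>. c \<cdot>\<^sub>m A \<in> \<A>) \<and> (\<forall>A\<in>\<A>. \<not> invertible_mat A)"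
  using matrix_vs[of N N, where 'a = 'k]
  unfolding singular_matrix_space_def VectorSpace.subspace_def submodule_def vectorspace_def
    matrix_vs_simps
  by auto

lemma conjugate_matrix_spaces_iff:
  "conjugate_matrix_spaces N \<A> \<A>' \<longleftrightarrow>
     (\<exists>g\<in>carrier_mat N N. \<exists>g'\<in>carrier_mat N N. \<exists>h\<in>carrier_mat N N. \<exists>h'\<in>carrier_mat N N.
        g * g' = 1\<^sub>m N \<and> g' * g = 1\<^sub>m N \<and> h * h' = 1\<^sub>m N \<and> h' * h = 1\<^sub>m N \<and>
        \<A>' = (\<lambda>A. g * A * h') ` \<A>)"
proof -
  have inverts: "inverts_mat h h' \<longleftrightarrow> h * h' = 1\<^sub>m N" if "h \<in> carrier_mat N N" for h h' :: "'a mat"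
    using that by (simp add: inverts_mat_def)
  have invertible: "invertible_mat g \<longleftrightarrow>
      (\<exists>g'\<in>carrier_mat N N. g * g' = 1\<^sub>m N \<and> g' * g = 1\<^sub>m N)"
    if g: "g \<in> carrier_mat N N" for g :: "'a mat"
  proof
    assume "invertible_mat g"
    then obtain g' where eqs: "g * g' = 1\<^sub>m N" "g' * g = 1\<^sub>m (dim_row g')"
      using g unfolding invertible_mat_def inverts_mat_def by auto
    have "dim_col (g * g') = N" "dim_col (g' * g) = dim_row g'"
      unfolding eqs by simp_all
    then have "g' \<in> carrier_mat N N"
      using g by auto
    then show "\<exists>g'\<in>carrier_mat N N. g * g' = 1\<^sub>m N \<and> g' * g = 1\<^sub>m N"
      using eqs by auto
  next
    assume "\<exists>g'\<in>carrier_mat N N. g * g' = 1\<^sub>m N \<and> g' * g = 1\<^sub>m N"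
    then show "invertible_mat g"
      using g unfolding invertible_mat_def inverts_mat_def by auto
  qed
  show ?thesis
    unfolding conjugate_matrix_spaces_def using inverts invertible by (simp cong: bex_cong) blast
qed

lemma conjugate_matrix_spaces_refl:
  assumes "\<A> \<subseteq> carrier_mat N N"
  shows "conjugate_matrix_spaces N \<A> \<A>"
proof -
  have "(\<lambda>A. 1\<^sub>m N * A * 1\<^sub>m N) ` \<A> = (\<lambda>A. A) ` \<A>"
    by (rule image_cong) (use assms in \<open>auto simp: subset_iff\<close>)
  then have "\<A> = (\<lambda>A. 1\<^sub>m N * A * 1\<^sub>m N) ` \<A>"
    by simp
  then show ?thesis
    unfolding conjugate_matrix_spaces_iff
    by (metis one_carrier_mat right_mult_one_mat)
qed

lemma conjugate_matrix_spaces_sym: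
  assumes sub: "\<A> \<subseteq> carrier_mat N N" and "conjugate_matrix_spaces N \<A> \<B>"
  shows "conjugate_matrix_spaces N \<B> \<A>"
proof -
  obtain g g' h h' where c: "g \<in> carrier_mat N N" "g' \<in> carrier_mat N N"
      "h \<in> carrier_mat N N" "h' \<in> carrier_mat N N"
    and inv: "g * g' = 1\<^sub>m N" "g' * g = 1\<^sub>m N" "h * h' = 1\<^sub>m N" "h' * h = 1\<^sub>m N"
    and B: "\<B> = (\<lambda>A. g * A * h') ` \<A>"
    using assms(2) unfolding conjugate_matrix_spaces_iff by blast
  have undo: "g' * (g * A * h') * h = A" if "A \<in> \<A>" for A
  proof -
    have A: "A \<in> carrier_mat N N" using that sub by blast
    have "g' * (g * A * h') * h = (g' * g) * A * (h' * h)"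
      using A c by (simp add: assoc_mult_mat[of _ N N _ N _ N])
    also have "\<dots> = A"
      using A unfolding inv by simp
    finally show ?thesis .
  qed
  have "(\<lambda>B. g' * B * h) ` \<B> = (\<lambda>A. A) ` \<A>"
    unfolding B image_image by (rule image_cong) (simp_all add: undo)
  then have "\<A> = (\<lambda>B. g' * B * h) ` \<B>"
    by simp
  then show ?thesis
    unfolding conjugate_matrix_spaces_iff using c inv by blast
qed

lemma conjugate_matrix_spaces_trans:
  assumes sub: "\<A> \<subseteq> carrier_mat N N"
    and "conjugate_matrix_spaces N \<A> \<B>" and "conjugate_matrix_spaces N \<B> \<C>"
  shows "conjugate_matrix_spaces N \<A> \<C>"
proof -
  obtain g g' h h' where c: "g \<in> carrier_mat N N" "g' \<in> carrier_mat N N"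
      "h \<in> carrier_mat N N" "h' \<in> carrier_mat N N"
    and inv: "g * g' = 1\<^sub>m N" "g' * g = 1\<^sub>m N" "h * h' = 1\<^sub>m N" "h' * h = 1\<^sub>m N"
    and B: "\<B> = (\<lambda>A. g * A * h') ` \<A>"
    using assms(2) unfolding conjugate_matrix_spaces_iff by blast
  obtain k k' l l' where d: "k \<in> carrier_mat N N" "k' \<in> carrier_mat N N"
      "l \<in> carrier_mat N N" "l' \<in> carrier_mat N N"
    and inv2: "k * k' = 1\<^sub>m N" "k' * k = 1\<^sub>m N" "l * l' = 1\<^sub>m N" "l' * l = 1\<^sub>m N"
    and C: "\<C> = (\<lambda>A. k * A * l') ` \<B>"
    using assms(3) unfolding conjugate_matrix_spaces_iff by blast
  have inv_mult: "(p * q) * (q' * p') = 1\<^sub>m N"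
    if "p \<in> carrier_mat N N" "q \<in> carrier_mat N N" "p' \<in> carrier_mat N N" "q' \<in> carrier_mat N N"
      "p * p' = 1\<^sub>m N" "q * q' = 1\<^sub>m N" for p q p' q' :: "'a mat"
  proof -
    have "(p * q) * (q' * p') = p * ((q * q') * p')"
      using that(1-4) by (simp add: assoc_mult_mat[of _ N N _ N _ N])
    also have "\<dots> = 1\<^sub>m N"
      using that by simp
    finally show ?thesis .
  qed
  have eq: "k * (g * A * h') * l' = (k * g) * A * (h' * l')" if "A \<in> \<A>" for A
  proof -
    have "A \<in> carrier_mat N N" using that sub by blast
    then show ?thesis using c d by (simp add: assoc_mult_mat[of _ N N _ N _ N])
  qed
  have "\<C> = (\<lambda>A. (k * g) * A * (h' * l')) ` \<A>"
    unfolding B C image_image by (rule image_cong) (simp_all add: eq)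
  moreover note inv_mult[OF d(1) c(1) d(2) c(2) inv2(1) inv(1)]
    inv_mult[OF c(2) d(2) c(1) d(1) inv(2) inv2(2)]
    inv_mult[OF d(3) c(3) d(4) c(4) inv2(3) inv(3)]
    inv_mult[OF c(4) d(4) c(3) d(3) inv(4) inv2(4)]
    mult_carrier_mat[OF d(1) c(1)] mult_carrier_mat[OF c(2) d(2)]
    mult_carrier_mat[OF d(3) c(3)] mult_carrier_mat[OF c(4) d(4)]
  ultimately show ?thesis
    unfolding conjugate_matrix_spaces_iff by blast
qed

lemma equiv_conjugacy_rel:
  "equiv {\<A> :: 'k::field mat set. singular_matrix_space N \<A>} (conjugacy_rel N)"
  (is "equiv ?S ?r")
proof -
  have sub: "\<A> \<subseteq> carrier_mat N N" if "singular_matrix_space N \<A>" for \<A> :: "'k mat set"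
    using that by (simp add: singular_matrix_space_iff)
  show ?thesis
  proof (rule equivI)
    show "?r \<subseteq> ?S \<times> ?S"
      by (auto simp: conjugacy_rel_def)
    show "refl_on ?S ?r"
      using conjugate_matrix_spaces_refl[OF sub] by (auto simp: refl_on_def conjugacy_rel_def)
    show "sym ?r"
      using conjugate_matrix_spaces_sym[OF sub] by (auto simp: sym_def conjugacy_rel_def)
    show "trans ?r"
      using conjugate_matrix_spaces_trans[OF sub] unfolding trans_def conjugacy_rel_def by blast
  qed
qed

end

theory Submission
  imports Defs
begin

text \<open>Let \<open>A\<^sub>0, \<dots>, A\<^sub>N\<^sub>-\<^sub>1\<close> be alternating \<open>N \<times> N\<close> matrices, and for a vector \<open>x\<close> let \<open>M x\<close> be the matrix with
  columns \<open>A\<^sub>k x\<close>. Since \<open>x\<^sup>T A\<^sub>k x = 0\<close>, the matrices \<open>M x\<close> form a singular matrix space. The tuples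
  \<open>(A\<^sub>k)\<close>, called tensors, have \<open>N\<^sup>2 (N - 1) / 2\<close> coordinates. Two facts give the theorem.

  A general tensor yields a maximal singular space. If \<open>M x + t B\<close> is singular for all \<open>t\<close> then
  \<open>C B C = 0\<close> for the adjugate \<open>C\<close> of \<open>M x\<close> (\<open>adj_sandwich_eq_0\<close>). For varying \<open>x\<close> these are linear
  conditions on \<open>B\<close>, and the space is maximal if they have no solutions besides the matrices \<open>M x\<close>.
  This follows from the nonvanishing of two determinants that are polynomial in the tensor
  (\<open>maximal_skew_space\<close>), so it is an open condition, and it suffices to satisfy it once. For
  \<open>A\<^sub>k = e\<^sub>k \<and> e\<^sub>k\<^sub>+\<^sub>1\<close> with indices modulo \<open>N\<close>, the adjugate of \<open>M x\<close> is a multiple of the matrix with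
  entries \<open>x\<^sub>i / (x\<^sub>k x\<^sub>k\<^sub>+\<^sub>1)\<close>, and the conditions reduce to the linear independence of distinct monomials
  (\<open>cyclic_functionals_separate\<close>).

  A conjugacy class contains few of these spaces. For general tensors and general \<open>x\<close> the left kernel of \<open>M x\<close> is
  spanned by \<open>x\<close>, so that a conjugation of two spaces comes from a pair of matrices which transforms
  one tensor into the other, and by homogeneity one entry of the first matrix may be taken to be
  \<open>1\<close> (\<open>conjugate_skew_spaces\<close>). This leaves \<open>2 N\<^sup>2 - 1\<close> parameters, fewer than \<open>N\<^sup>2 (N - 1) / 2\<close> for
  \<open>N \<ge> 5\<close>. By algebraic dependence, the general tensors whose space is conjugate to a given one
  lie in a finite union of hypersurfaces (\<open>conjugacy_class_hypersurfaces\<close>). As the field is infinite, finitely many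
  hypersurfaces do not cover a nonempty open set.\<close>

section \<open>Polynomial functions\<close>

text \<open>Functions of one variable that are given by a polynomial.\<close>

definition poly_fun :: "('k::field \<Rightarrow> 'k) \<Rightarrow> bool" where
  "poly_fun f \<longleftrightarrow> (\<exists>p. \<forall>t. f t = poly p t)"

lemma poly_fun_const: "poly_fun (\<lambda>t. c)"
  unfolding poly_fun_def by (rule exI[of _ "[:c:]"]) simp

lemma poly_fun_id: "poly_fun (\<lambda>t. t)"
  unfolding poly_fun_def by (rule exI[of _ "[:0, 1:]"]) simp

lemma poly_fun_add: "poly_fun f \<Longrightarrow> poly_fun g \<Longrightarrow> poly_fun (\<lambda>t. f t + g t)"
  unfolding poly_fun_def by (metis poly_add)

lemma poly_fun_mult: "poly_fun f \<Longrightarrow> poly_fun g \<Longrightarrow> poly_fun (\<lambda>t. f t * g t)"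
  unfolding poly_fun_def by (metis poly_mult)

lemma poly_fun_diff: "poly_fun f \<Longrightarrow> poly_fun g \<Longrightarrow> poly_fun (\<lambda>t. f t - g t)"
  unfolding poly_fun_def by (metis poly_diff)

lemma poly_fun_sum: "(\<And>i. i \<in> A \<Longrightarrow> poly_fun (f i)) \<Longrightarrow> poly_fun (\<lambda>t. \<Sum>i\<in>A. f i t)"
  by (induction A rule: infinite_finite_induct) (auto intro: poly_fun_const poly_fun_add)

lemma poly_fun_prod: "(\<And>i. i \<in> A \<Longrightarrow> poly_fun (f i)) \<Longrightarrow> poly_fun (\<lambda>t. \<Prod>i\<in>A. f i t)"
  by (induction A rule: infinite_finite_induct) (auto intro: poly_fun_const poly_fun_mult)

lemma poly_fun_power: "poly_fun f \<Longrightarrow> poly_fun (\<lambda>t. f t ^ n)"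
  by (induction n) (auto intro: poly_fun_const poly_fun_mult)

lemmas poly_fun_intros = poly_fun_const poly_fun_id poly_fun_add poly_fun_mult poly_fun_diff
  poly_fun_sum poly_fun_prod poly_fun_power

lemma poly_fun_zero_off_finite:
  assumes "infinite (UNIV :: 'k::field set)" and "poly_fun (f :: 'k \<Rightarrow> 'k)"
    and "finite Z" and "\<And>t. t \<notin> Z \<Longrightarrow> f t = 0"
  shows "f s = 0"
proof -
  obtain p where p: "\<And>t. f t = poly p t"
    using assms(2) unfolding poly_fun_def by blast
  have "infinite (- Z)"
    using assms(1,3) by (simp add: Compl_eq_Diff_UNIV)
  moreover have "- Z \<subseteq> {t. poly p t = 0}"
    using assms(4) p by auto
  ultimately have "p = 0"
    using poly_roots_finite[of p] finite_subset by blast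
  then show ?thesis
    using p by simp
qed

text \<open>A function of arbitrarily many coordinates that is polynomial along every affine line. Over an
  infinite field, nonvanishing of such a function serves as a Zariski-open condition: this avoids
  multivariate polynomials, and the next lemma says that finitely many nonempty conditions of this
  kind meet.\<close>

definition line_poly :: "(('a \<Rightarrow> 'k::field) \<Rightarrow> 'k) \<Rightarrow> bool" where
  "line_poly f \<longleftrightarrow> (\<forall>u v. poly_fun (\<lambda>s. f (\<lambda>j. u j + s * v j)))"

lemma line_poly_common_nonzero:
  fixes F :: "(('a \<Rightarrow> 'k::field) \<Rightarrow> 'k) set"
  assumes inf: "infinite (UNIV :: 'k set)" and "finite F"
    and "\<And>f. f \<in> F \<Longrightarrow> line_poly f" and "\<And>f. f \<in> F \<Longrightarrow> \<exists>x. f x \<noteq> 0"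
  shows "\<exists>x. \<forall>f\<in>F. f x \<noteq> 0"
  using assms(2-4)
proof (induction F rule: finite_induct)
  case empty
  then show ?case by simp
next
  case (insert f F)
  obtain x where x: "\<forall>g\<in>F. g x \<noteq> 0"
    using insert.IH insert.prems by blast
  obtain y where y: "f y \<noteq> 0"
    using insert.prems by blast
  define l where "l s = (\<lambda>j. x j + s * (y j - x j))" for s
  have l01: "l 0 = x" "l 1 = y"
    by (auto simp: l_def)
  have "finite {s. g (l s) = 0}" if g: "g \<in> insert f F" for g
  proof -
    have "poly_fun (\<lambda>s. g (l s))"
      using insert.prems(1)[OF g, unfolded line_poly_def, rule_format, of x "\<lambda>j. y j - x j"]
      unfolding l_def .
    then obtain p where p: "\<And>s. g (l s) = poly p s"
      unfolding poly_fun_def by blast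
    have "g (l 0) \<noteq> 0 \<or> g (l 1) \<noteq> 0"
      using x y g l01 by auto
    then have "p \<noteq> 0"
      using p by auto
    then show ?thesis
      using poly_roots_finite[of p] p by simp
  qed
  then have "finite (\<Union>g\<in>insert f F. {s. g (l s) = 0})"
    using insert.hyps(1) by blast
  then obtain s where "s \<notin> (\<Union>g\<in>insert f F. {s. g (l s) = 0})"
    using inf ex_new_if_finite by blast
  then show ?case
    by blast
qed

text \<open>An identity that holds off the zero set of a nonzero \<open>f\<close> holds everywhere.\<close>

lemma line_poly_mult_eq_0:
  fixes f g :: "('a \<Rightarrow> 'k::field) \<Rightarrow> 'k"
  assumes "infinite (UNIV :: 'k set)" and "line_poly f" and "line_poly g"
    and "\<And>x. f x \<noteq> 0 \<Longrightarrow> g x = 0" and "f x0 \<noteq> 0"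
  shows "g x = 0"
proof (rule ccontr)
  assume "g x \<noteq> 0"
  then have "\<exists>x. \<forall>h\<in>{f, g}. h x \<noteq> 0"
    using assms by (intro line_poly_common_nonzero) auto
  then show False
    using assms(4) by auto
qed

section \<open>Algebraic dependence\<close>

lemma underdetermined_system:
  fixes a :: "'x \<Rightarrow> 'y \<Rightarrow> 'k::field"
  assumes "finite Y" and "finite X" and "card Y < card X"
  shows "\<exists>c. (\<exists>x\<in>X. c x \<noteq> 0) \<and> (\<forall>y\<in>Y. (\<Sum>x\<in>X. c x * a x y) = 0)"
  using assms
proof (induction Y arbitrary: X a rule: finite_induct)
  case empty
  then have "X \<noteq> {}" by auto
  then show ?case
    by (intro exI[of _ "\<lambda>_. 1"]) auto
next
  case (insert z Y)
  show ?case
  proof (cases "\<forall>x\<in>X. a x z = 0")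
    case True
    have "card Y < card X"
      using insert.hyps insert.prems by simp
    then obtain c where "\<exists>x\<in>X. c x \<noteq> 0" "\<forall>y\<in>Y. (\<Sum>x\<in>X. c x * a x y) = 0"
      using insert.IH[OF insert.prems(1), of a] by blast
    then show ?thesis
      using True by (intro exI[of _ c]) simp
  next
    case False
    then obtain w where w: "w \<in> X" "a w z \<noteq> 0"
      by blast
    define a' where "a' x y = a x y - a x z / a w z * a w y" for x y
    have "card Y < card (X - {w})"
      using insert.hyps insert.prems w by simp
    then obtain c where c: "\<exists>x\<in>X - {w}. c x \<noteq> 0"
      and c0: "\<forall>y\<in>Y. (\<Sum>x\<in>X - {w}. c x * a' x y) = 0"
      using insert.IH[of "X - {w}" a'] insert.prems by blast
    define d where "d = c(w := - (\<Sum>x\<in>X - {w}. c x * (a x z / a w z)))"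
    have eq: "(\<Sum>x\<in>X. d x * a x y) = (\<Sum>x\<in>X - {w}. c x * a' x y)" for y
    proof -
      have "(\<Sum>x\<in>X. d x * a x y) = d w * a w y + (\<Sum>x\<in>X - {w}. d x * a x y)"
        using insert.prems w by (simp add: sum.remove)
      also have "\<dots> = (\<Sum>x\<in>X - {w}. c x * a x y - c x * (a x z / a w z) * a w y)"
        by (simp add: d_def sum_subtractf sum_distrib_right)
      also have "\<dots> = (\<Sum>x\<in>X - {w}. c x * a' x y)"
        by (simp add: a'_def algebra_simps)
      finally show ?thesis .
    qed
    have "a' x z = 0" for x
      using w by (simp add: a'_def)
    then have "\<forall>y\<in>insert z Y. (\<Sum>x\<in>X. d x * a x y) = 0"
      using c0 eq by simp
    moreover have "\<exists>x\<in>X. d x \<noteq> 0"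
      using c by (auto simp: d_def)
    ultimately show ?thesis
      by blast
  qed
qed

text \<open>Distinct monomials over an infinite field are linearly independent, even as functions on the
  points all of whose coordinates are nonzero.\<close>

lemma monomials_independent:
  fixes a :: "'e \<Rightarrow> 'k::field" and \<mu> :: "'e \<Rightarrow> 'j \<Rightarrow> nat"
  assumes inf: "infinite (UNIV :: 'k set)" and "finite J" and "finite E"
    and "inj_on (\<lambda>e. restrict (\<mu> e) J) E"
    and "\<And>x. (\<And>j. x j \<noteq> 0) \<Longrightarrow> (\<Sum>e\<in>E. a e * (\<Prod>j\<in>J. x j ^ \<mu> e j)) = 0"
    and "e \<in> E"
  shows "a e = 0"
  using assms(2-6)
proof (induction J arbitrary: E e rule: finite_induct)
  case empty
  have "E = {e}"
    using empty.prems(2,4) by (auto simp: inj_on_def restrict_def)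
  then show ?case
    using empty.prems(3)[of "\<lambda>_. 1"] by simp
next
  case (insert i J)
  define E' where "E' = {f \<in> E. \<mu> f i = \<mu> e i}"
  have "a e = 0"
  proof (rule insert.IH)
    show "finite E'" "e \<in> E'"
      using insert.prems by (auto simp: E'_def)
    show "inj_on (\<lambda>e. restrict (\<mu> e) J) E'"
    proof (rule inj_onI)
      fix f g assume f: "f \<in> E'" and g: "g \<in> E'"
        and eq: "restrict (\<mu> f) J = restrict (\<mu> g) J"
      have "\<mu> f j = \<mu> g j" if "j \<in> insert i J" for j
        using that f g fun_cong[OF eq, of j] by (auto simp: E'_def)
      then have "restrict (\<mu> f) (insert i J) = restrict (\<mu> g) (insert i J)"
        by (rule restrict_ext)
      then show "f = g"
        by (rule inj_onD[OF insert.prems(2)]) (use f g in \<open>auto simp: E'_def\<close>)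
    qed
    fix x :: "'j \<Rightarrow> 'k" assume x: "\<And>j. x j \<noteq> 0"
    define p where "p = (\<Sum>f\<in>E. monom (a f * (\<Prod>j\<in>J. x j ^ \<mu> f j)) (\<mu> f i))"
    have "poly p t = 0" if "t \<notin> {0}" for t
    proof -
      have *: "a f * (\<Prod>j\<in>J. x j ^ \<mu> f j) * t ^ \<mu> f i =
          a f * (\<Prod>j\<in>insert i J. (x(i := t)) j ^ \<mu> f j)" for f
      proof -
        have "(\<Prod>j\<in>J. (x(i := t)) j ^ \<mu> f j) = (\<Prod>j\<in>J. x j ^ \<mu> f j)"
          using insert.hyps by (intro prod.cong) auto
        then show ?thesis
          using insert.hyps by simp
      qed
      have "poly p t = (\<Sum>f\<in>E. a f * (\<Prod>j\<in>insert i J. (x(i := t)) j ^ \<mu> f j))"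
        unfolding p_def poly_sum poly_monom * ..
      also have "\<dots> = 0"
        using x that by (intro insert.prems(3)) auto
      finally show ?thesis .
    qed
    then have "- {0} \<subseteq> {t. poly p t = 0}"
      by auto
    moreover have "infinite (- {0 :: 'k})"
      using inf by (simp add: Compl_eq_Diff_UNIV)
    ultimately have "p = 0"
      using poly_roots_finite[of p] finite_subset by blast
    then have "0 = coeff p (\<mu> e i)"
      by simp
    also have "\<dots> = (\<Sum>f\<in>E. if \<mu> f i = \<mu> e i then a f * (\<Prod>j\<in>J. x j ^ \<mu> f j) else 0)"
      by (simp add: p_def coeff_sum)
    also have "\<dots> = (\<Sum>f\<in>E'. a f * (\<Prod>j\<in>J. x j ^ \<mu> f j))"
      unfolding E'_def using insert.prems(1) by (rule sum.inter_filter[symmetric])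
    finally show "(\<Sum>f\<in>E'. a f * (\<Prod>j\<in>J. x j ^ \<mu> f j)) = 0" ..
  qed
  then show ?case .
qed

text \<open>\<open>f\<close> is a polynomial of degree at most \<open>d\<close> in each variable from \<open>I\<close> separately.\<close>

definition sep_degree_le :: "'i set \<Rightarrow> nat \<Rightarrow> (('i \<Rightarrow> 'k::field) \<Rightarrow> 'k) \<Rightarrow> bool" where
  "sep_degree_le I d f \<longleftrightarrow> (\<forall>i\<in>I. \<forall>y. \<exists>p. degree p \<le> d \<and> (\<forall>t. f (y(i := t)) = poly p t))"

lemma sep_degree_le_const: "sep_degree_le I d (\<lambda>y. c)"
  unfolding sep_degree_le_def by (intro ballI allI exI[of _ "[:c:]"]) simp

lemma sep_degree_le_coord: "sep_degree_le I 1 (\<lambda>y. y i)"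
proof -
  have "\<exists>p. degree p \<le> 1 \<and> (\<forall>t. (y(j := t)) i = poly p t)" for y :: "'a \<Rightarrow> 'b" and j
    by (rule exI[of _ "if i = j then [:0, 1:] else [:y i:]"]) simp
  then show ?thesis
    unfolding sep_degree_le_def by blast
qed

lemma sep_degree_le_mono: "sep_degree_le I d f \<Longrightarrow> d \<le> d' \<Longrightarrow> sep_degree_le I d' f"
  unfolding sep_degree_le_def by (meson order_trans)

lemma sep_degree_le_mult:
  assumes "sep_degree_le I d f" and "sep_degree_le I d' g"
  shows "sep_degree_le I (d + d') (\<lambda>y. f y * g y)"
  unfolding sep_degree_le_def
proof (intro ballI allI)
  fix i y assume "i \<in> I"
  then obtain p q where p: "degree p \<le> d" "\<forall>t. f (y(i := t)) = poly p t"
    and q: "degree q \<le> d'" "\<forall>t. g (y(i := t)) = poly q t"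
    using assms unfolding sep_degree_le_def by meson
  have "degree (p * q) \<le> d + d'"
    using p q degree_mult_le[of p q] by linarith
  then show "\<exists>p. degree p \<le> d + d' \<and> (\<forall>t. f (y(i := t)) * g (y(i := t)) = poly p t)"
    using p q by (intro exI[of _ "p * q"]) simp
qed

lemma sep_degree_le_add:
  assumes "sep_degree_le I d f" and "sep_degree_le I d g"
  shows "sep_degree_le I d (\<lambda>y. f y + g y)"
  unfolding sep_degree_le_def
proof (intro ballI allI)
  fix i y assume "i \<in> I"
  then obtain p q where p: "degree p \<le> d" "\<forall>t. f (y(i := t)) = poly p t"
    and q: "degree q \<le> d" "\<forall>t. g (y(i := t)) = poly q t"
    using assms unfolding sep_degree_le_def by meson
  then show "\<exists>p. degree p \<le> d \<and> (\<forall>t. f (y(i := t)) + g (y(i := t)) = poly p t)"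
    by (intro exI[of _ "p + q"]) (simp add: degree_add_le)
qed

lemma sep_degree_le_sum:
  "(\<And>x. x \<in> A \<Longrightarrow> sep_degree_le I d (f x)) \<Longrightarrow> sep_degree_le I d (\<lambda>y. \<Sum>x\<in>A. f x y)"
  by (induction A rule: infinite_finite_induct)
    (auto intro: sep_degree_le_const sep_degree_le_add)

lemma sep_degree_le_power: "sep_degree_le I d f \<Longrightarrow> sep_degree_le I (n * d) (\<lambda>y. f y ^ n)"
  by (induction n) (auto intro: sep_degree_le_const sep_degree_le_mult)

lemma sep_degree_le_prod:
  "finite A \<Longrightarrow> (\<And>x. x \<in> A \<Longrightarrow> sep_degree_le I d (f x)) \<Longrightarrow>
    sep_degree_le I (card A * d) (\<lambda>y. \<Prod>x\<in>A. f x y)"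
  by (induction A rule: finite_induct)
    (auto intro: sep_degree_le_const sep_degree_le_mult)

lemma sep_degree_le_zero_on_grid:
  assumes "finite I" and "sep_degree_le I d f" and "finite G" and "d < card G"
    and "\<And>z. (\<And>i. i \<in> I \<Longrightarrow> z i \<in> G) \<Longrightarrow> (\<And>i. i \<notin> I \<Longrightarrow> z i = y i) \<Longrightarrow> f z = 0"
  shows "f y = 0"
  using assms(1,2,5)
proof (induction I arbitrary: y rule: finite_induct)
  case empty
  then show ?case by simp
next
  case (insert i I)
  have sub: "sep_degree_le I d f"
    using insert.prems(1) unfolding sep_degree_le_def by blast
  obtain p where p: "degree p \<le> d" "\<And>t. f (y(i := t)) = poly p t"
    using insert.prems(1) unfolding sep_degree_le_def by blast
  have "poly p t = 0" if t: "t \<in> G" for t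
  proof -
    have "f (y(i := t)) = 0"
    proof (rule insert.IH[OF sub])
      fix z assume z: "\<And>j. j \<in> I \<Longrightarrow> z j \<in> G" "\<And>j. j \<notin> I \<Longrightarrow> z j = (y(i := t)) j"
      show "f z = 0"
      proof (rule insert.prems(2))
        show "z j \<in> G" if "j \<in> insert i I" for j
          using that z t insert.hyps(2) by (cases "j = i") auto
        show "z j = y j" if "j \<notin> insert i I" for j
          using that z by auto
      qed
    qed
    then show ?thesis
      using p by simp
  qed
  then have "G \<subseteq> {t. poly p t = 0}"
    by auto
  have "p = 0"
  proof (rule ccontr)
    assume "p \<noteq> 0"
    then have "card G \<le> degree p"
      using card_mono[OF poly_roots_finite \<open>G \<subseteq> _\<close>] card_poly_roots_bound[of p]
      by (meson order_trans)
    then show False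
      using p(1) assms(4) by simp
  qed
  then show ?case
    using p(2)[of "y i"] by simp
qed

text \<open>If there are more functions \<open>\<lambda>y. \<phi> y j\<close> than variables in \<open>I\<close>, they satisfy a nontrivial polynomial relation.
  Allowing exponents up to \<open>D\<close> gives \<open>(D + 1) ^ card J\<close> monomials in the functions. Their degree in
  each variable is at most \<open>card J * D * m\<close>, so that it suffices to impose the relation on a grid of
  \<open>(card J * D * m + 1) ^ card I\<close> points, which are fewer equations than unknowns for large \<open>D\<close>.
  The variables outside \<open>I\<close> are fixed at the values \<open>y0\<close>.\<close>

lemma algebraic_dependence:
  fixes \<phi> :: "('i \<Rightarrow> 'k::field) \<Rightarrow> 'j \<Rightarrow> 'k" and y0 :: "'i \<Rightarrow> 'k"
  assumes inf: "infinite (UNIV :: 'k set)" and I: "finite I" and J: "finite J"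
    and card: "card I < card J"
    and deg: "\<And>j. j \<in> J \<Longrightarrow> sep_degree_le I m (\<lambda>y. \<phi> y j)"
  shows "\<exists>(E :: ('j \<Rightarrow> nat) set) a. finite E \<and>
    (\<exists>z. (\<Sum>e\<in>E. a e * (\<Prod>j\<in>J. z j ^ e j)) \<noteq> 0) \<and>
    (\<forall>y. (\<forall>i. i \<notin> I \<longrightarrow> y i = y0 i) \<longrightarrow> (\<Sum>e\<in>E. a e * (\<Prod>j\<in>J. \<phi> y j ^ e j)) = 0)"
proof -
  define D where "D = (card J * m + 1) ^ card I"
  define d where "d = card J * (D * m)"
  define E where "E = (J \<rightarrow>\<^sub>E {..D} :: ('j \<Rightarrow> nat) set)"
  obtain G :: "'k set" where G: "finite G" "card G = d + 1"
    using inf infinite_arbitrarily_large by blast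
  define Y where "Y = (\<lambda>g i. if i \<in> I then g i else y0 i) ` (I \<rightarrow>\<^sub>E G)"
  have E: "finite E" "card E = (D + 1) ^ card J"
    using J by (auto simp: E_def finite_PiE card_PiE)
  have Y: "finite Y" "card Y \<le> (d + 1) ^ card I"
  proof -
    show "finite Y"
      unfolding Y_def using I G by (simp add: finite_PiE)
    have "card Y \<le> card (I \<rightarrow>\<^sub>E G)"
      unfolding Y_def using I G by (intro card_image_le finite_PiE) auto
    then show "card Y \<le> (d + 1) ^ card I"
      using I G by (simp add: card_PiE)
  qed
  have "d + 1 \<le> (card J * m + 1) * (D + 1)"
    by (simp add: d_def algebra_simps)
  then have "(d + 1) ^ card I \<le> ((card J * m + 1) * (D + 1)) ^ card I"
    by (rule power_mono) simp
  also have "\<dots> = D * (D + 1) ^ card I"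
    unfolding power_mult_distrib D_def ..
  also have "\<dots> < (D + 1) ^ Suc (card I)"
    by simp
  also have "\<dots> \<le> (D + 1) ^ card J"
    using card by (intro power_increasing) auto
  finally have "card Y < card E"
    using E Y by linarith
  then obtain a where a: "\<exists>e\<in>E. a e \<noteq> 0"
    and a0: "\<forall>y\<in>Y. (\<Sum>e\<in>E. a e * (\<Prod>j\<in>J. \<phi> y j ^ e j)) = 0"
    using underdetermined_system[OF Y(1) E(1), of "\<lambda>e y. \<Prod>j\<in>J. \<phi> y j ^ e j"] by blast
  have "\<exists>z. (\<Sum>e\<in>E. a e * (\<Prod>j\<in>J. z j ^ e j)) \<noteq> 0"
  proof (rule ccontr)
    assume "\<not> ?thesis"
    then have z: "(\<Sum>e\<in>E. a e * (\<Prod>j\<in>J. z j ^ e j)) = 0" for z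
      by blast
    have "inj_on (\<lambda>e. restrict e J) E"
      unfolding E_def inj_on_def by (simp add: PiE_restrict)
    then have "a e = 0" if "e \<in> E" for e
      using monomials_independent[OF inf J E(1), of "\<lambda>e. e" a] z that by blast
    then show False
      using a by blast
  qed
  moreover have "(\<Sum>e\<in>E. a e * (\<Prod>j\<in>J. \<phi> y j ^ e j)) = 0" if y: "\<forall>i. i \<notin> I \<longrightarrow> y i = y0 i" for y
  proof (rule sep_degree_le_zero_on_grid[OF I _ G(1),
        where f = "\<lambda>y. \<Sum>e\<in>E. a e * (\<Prod>j\<in>J. \<phi> y j ^ e j)"])
    show "d < card G"
      using G by simp
    show "sep_degree_le I d (\<lambda>y. \<Sum>e\<in>E. a e * (\<Prod>j\<in>J. \<phi> y j ^ e j))"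
    proof (rule sep_degree_le_sum)
      fix e assume e: "e \<in> E"
      have "sep_degree_le I (D * m) (\<lambda>y. \<phi> y j ^ e j)" if j: "j \<in> J" for j
      proof -
        have "e j \<le> D"
          using e j by (auto simp: E_def PiE_def Pi_def)
        then show ?thesis
          using sep_degree_le_power[OF deg[OF j]] by (rule_tac sep_degree_le_mono) auto
      qed
      then have "sep_degree_le I (0 + d) (\<lambda>y. a e * (\<Prod>j\<in>J. \<phi> y j ^ e j))"
        unfolding d_def using J by (intro sep_degree_le_mult sep_degree_le_const sep_degree_le_prod)
      then show "sep_degree_le I d (\<lambda>y. a e * (\<Prod>j\<in>J. \<phi> y j ^ e j))"
        by simp
    qed
    fix z assume z: "\<And>i. i \<in> I \<Longrightarrow> z i \<in> G" "\<And>i. i \<notin> I \<Longrightarrow> z i = y i"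
    have "z = (\<lambda>i. if i \<in> I then restrict z I i else y0 i)"
      using z y by auto
    moreover have "restrict z I \<in> I \<rightarrow>\<^sub>E G"
      using z by auto
    ultimately have "z \<in> Y"
      unfolding Y_def by blast
    then show "(\<Sum>e\<in>E. a e * (\<Prod>j\<in>J. \<phi> z j ^ e j)) = 0"
      using a0 by blast
  qed
  ultimately show ?thesis
    using E(1) by blast
qed

section \<open>Square matrices given by their entries\<close>

definition sq_mat :: "nat \<Rightarrow> (nat \<Rightarrow> nat \<Rightarrow> 'k) \<Rightarrow> 'k mat" where
  "sq_mat n E = mat n n (\<lambda>(i, j). E i j)"

lemma sq_mat_carrier [simp]: "sq_mat n E \<in> carrier_mat n n"
  by (simp add: sq_mat_def)

lemma sq_mat_index [simp]: "i < n \<Longrightarrow> j < n \<Longrightarrow> sq_mat n E $$ (i, j) = E i j"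
  by (simp add: sq_mat_def)

lemma sq_mat_dim [simp]: "dim_row (sq_mat n E) = n" "dim_col (sq_mat n E) = n"
  by (simp_all add: sq_mat_def)

lemma sq_mat_eq_iff: "sq_mat n E = sq_mat n F \<longleftrightarrow> (\<forall>i<n. \<forall>j<n. E i j = F i j)"
  by (auto simp: mat_eq_iff)

lemma index_mult_mat_sum:
  assumes "A \<in> carrier_mat n n" "B \<in> carrier_mat n n" "i < n" "j < n"
  shows "(A * B) $$ (i, j) = (\<Sum>k<n. A $$ (i, k) * B $$ (k, j))"
  using assms by (simp add: scalar_prod_def atLeast0LessThan)

lemma det_sq_mat_eq_0_iff:
  fixes E :: "nat \<Rightarrow> nat \<Rightarrow> 'k::field"
  shows "det (sq_mat n E) = 0 \<longleftrightarrow>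
    (\<exists>v. (\<exists>j<n. v j \<noteq> 0) \<and> (\<forall>i<n. (\<Sum>j<n. E i j * v j) = 0))"
proof -
  have "(\<exists>v. v \<in> carrier_vec n \<and> v \<noteq> 0\<^sub>v n \<and> sq_mat n E *\<^sub>v v = 0\<^sub>v n) \<longleftrightarrow>
      (\<exists>v. (\<exists>j<n. v j \<noteq> 0) \<and> (\<forall>i<n. (\<Sum>j<n. E i j * v j) = 0))" (is "?L \<longleftrightarrow> ?R")
  proof
    assume ?L
    then obtain v where v: "v \<in> carrier_vec n" "v \<noteq> 0\<^sub>v n" "sq_mat n E *\<^sub>v v = 0\<^sub>v n"
      by blast
    have "\<exists>j<n. v $ j \<noteq> 0"
    proof (rule ccontr)
      assume "\<not> ?thesis"
      then have "v = 0\<^sub>v n"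
        using v(1) by (intro eq_vecI) auto
      then show False
        using v(2) by simp
    qed
    moreover have "(\<Sum>j<n. E i j * v $ j) = 0" if "i < n" for i
    proof -
      have "(sq_mat n E *\<^sub>v v) $ i = 0"
        using v(3) that by simp
      then show ?thesis
        using v(1) that by (simp add: scalar_prod_def atLeast0LessThan)
    qed
    ultimately show ?R
      by blast
  next
    assume ?R
    then obtain v where v: "\<exists>j<n. v j \<noteq> 0" "\<forall>i<n. (\<Sum>j<n. E i j * v j) = 0"
      by blast
    have "vec n v \<noteq> 0\<^sub>v n"
      using v(1) by (metis index_vec index_zero_vec(1))
    moreover have "sq_mat n E *\<^sub>v vec n v = 0\<^sub>v n"
      using v(2) by (intro eq_vecI) (simp_all add: scalar_prod_def atLeast0LessThan)
    ultimately show ?L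
      using vec_carrier by blast
  qed
  then show ?thesis
    using det_0_iff_vec_prod_zero[of "sq_mat n E" n] by simp
qed

lemma det_sq_mat_transpose:
  fixes E :: "nat \<Rightarrow> nat \<Rightarrow> 'k::comm_ring_1"
  shows "det (sq_mat n (\<lambda>i j. E j i)) = det (sq_mat n E)"
proof -
  have "transpose_mat (sq_mat n E) = sq_mat n (\<lambda>i j. E j i)"
    by (rule eq_matI) auto
  then show ?thesis
    using det_transpose[of "sq_mat n E" n] by simp
qed

lemma det_sq_mat_eq_0_iff_left:
  fixes E :: "nat \<Rightarrow> nat \<Rightarrow> 'k::field"
  shows "det (sq_mat n E) = 0 \<longleftrightarrow>
    (\<exists>v. (\<exists>i<n. v i \<noteq> 0) \<and> (\<forall>j<n. (\<Sum>i<n. v i * E i j) = 0))"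
  using det_sq_mat_eq_0_iff[of n "\<lambda>i j. E j i"] det_sq_mat_transpose[of n E]
  by (simp add: mult.commute)

lemma det_nonzero_kernel_trivial:
  fixes E :: "nat \<Rightarrow> nat \<Rightarrow> 'k::field"
  assumes "det (sq_mat n E) \<noteq> 0" and "\<And>i. i < n \<Longrightarrow> (\<Sum>j<n. E i j * v j) = 0" and "j < n"
  shows "v j = 0"
proof (rule ccontr)
  assume "v j \<noteq> 0"
  then have "(\<exists>j<n. v j \<noteq> 0) \<and> (\<forall>i<n. (\<Sum>j<n. E i j * v j) = 0)"
    using assms(2,3) by blast
  then show False
    using assms(1) det_sq_mat_eq_0_iff[of n E] by blast
qed

lemma det_nonzero_left_kernel_trivial:
  fixes E :: "nat \<Rightarrow> nat \<Rightarrow> 'k::field"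
  assumes "det (sq_mat n E) \<noteq> 0" and "\<And>j. j < n \<Longrightarrow> (\<Sum>i<n. v i * E i j) = 0" and "i < n"
  shows "v i = 0"
proof (rule ccontr)
  assume "v i \<noteq> 0"
  then have "(\<exists>i<n. v i \<noteq> 0) \<and> (\<forall>j<n. (\<Sum>i<n. v i * E i j) = 0)"
    using assms(2,3) by blast
  then show False
    using assms(1) det_sq_mat_eq_0_iff_left[of n E] by blast
qed

text \<open>Entries of the adjugate.\<close>

definition adj_entry :: "nat \<Rightarrow> (nat \<Rightarrow> nat \<Rightarrow> 'k::comm_ring_1) \<Rightarrow> nat \<Rightarrow> nat \<Rightarrow> 'k" where
  "adj_entry n E i j = adj_mat (sq_mat n E) $$ (i, j)"

lemma adj_entry_left:
  assumes "i < n" "j < n"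
  shows "(\<Sum>k<n. adj_entry n E i k * E k j) = (if i = j then det (sq_mat n E) else 0)"
proof -
  have c: "sq_mat n E \<in> carrier_mat n n" by simp
  have "(adj_mat (sq_mat n E) * sq_mat n E) $$ (i, j) = (det (sq_mat n E) \<cdot>\<^sub>m 1\<^sub>m n) $$ (i, j)"
    unfolding adj_mat(3)[OF c] ..
  then show ?thesis
    using assms unfolding adj_entry_def index_mult_mat_sum[OF adj_mat(1)[OF c] c assms] by auto
qed

lemma adj_entry_right:
  assumes "i < n" "j < n"
  shows "(\<Sum>k<n. E i k * adj_entry n E k j) = (if i = j then det (sq_mat n E) else 0)"
proof -
  have c: "sq_mat n E \<in> carrier_mat n n" by simp
  have "(sq_mat n E * adj_mat (sq_mat n E)) $$ (i, j) = (det (sq_mat n E) \<cdot>\<^sub>m 1\<^sub>m n) $$ (i, j)"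
    unfolding adj_mat(2)[OF c] ..
  then show ?thesis
    using assms unfolding adj_entry_def index_mult_mat_sum[OF c adj_mat(1)[OF c] assms] by auto
qed

lemma linear_system_solvable:
  fixes E :: "nat \<Rightarrow> nat \<Rightarrow> 'k::field"
  assumes "det (sq_mat n E) \<noteq> 0"
  shows "\<exists>w. \<forall>i<n. (\<Sum>j<n. E i j * w j) = b i"
proof (intro exI allI impI)
  fix i assume i: "i < n"
  define d where "d = det (sq_mat n E)"
  have "(\<Sum>j<n. E i j * ((\<Sum>k<n. adj_entry n E j k * b k) / d)) =
      (\<Sum>j<n. \<Sum>k<n. E i j * adj_entry n E j k * b k) / d"
    by (simp add: sum_divide_distrib sum_distrib_left mult.assoc)
  also have "(\<Sum>j<n. \<Sum>k<n. E i j * adj_entry n E j k * b k) =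
      (\<Sum>k<n. (\<Sum>j<n. E i j * adj_entry n E j k) * b k)"
    by (subst sum.swap) (simp add: sum_distrib_right)
  also have "\<dots> = (\<Sum>k<n. if k = i then d * b i else 0)"
    by (rule sum.cong) (auto simp: adj_entry_right i d_def)
  also have "\<dots> = d * b i"
    using i by simp
  finally show "(\<Sum>j<n. E i j * ((\<Sum>k<n. adj_entry n E j k * b k) / d)) = b i"
    using assms by (simp add: d_def)
qed

lemma invertible_mat_iff_det:
  fixes A :: "'k::field mat"
  assumes A: "A \<in> carrier_mat n n"
  shows "invertible_mat A \<longleftrightarrow> det A \<noteq> 0"
proof
  assume "invertible_mat A"
  then obtain B where B: "A * B = 1\<^sub>m n" "B * A = 1\<^sub>m (dim_row B)"
    using A unfolding invertible_mat_def inverts_mat_def by auto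
  have "dim_col (A * B) = n" "dim_col (B * A) = dim_row B"
    unfolding B by simp_all
  then have "B \<in> carrier_mat n n"
    using A by auto
  then have "det A * det B = 1"
    using det_mult[OF A, of B] unfolding B(1) by simp
  then show "det A \<noteq> 0"
    by auto
next
  assume d: "det A \<noteq> 0"
  let ?B = "inverse (det A) \<cdot>\<^sub>m adj_mat A"
  have "A * ?B = 1\<^sub>m n" "?B * A = 1\<^sub>m n"
    using adj_mat[OF A] A d
    by (auto simp: mult_smult_distrib[OF A] mult_smult_assoc_mat[of _ n n _ n] intro!: eq_matI)
  then show "invertible_mat A"
    using A adj_mat(1)[OF A] unfolding invertible_mat_def inverts_mat_def by auto
qed

lemma mat_delete_sq_mat:
  "mat_delete (sq_mat n E) p q =
    sq_mat (n - 1) (\<lambda>i j. E (if i < p then i else Suc i) (if j < q then j else Suc j))"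
  unfolding mat_delete_def by (rule eq_matI) auto

text \<open>A diagonal entry of the adjugate, as the determinant of the matrix whose column \<open>p\<close> is replaced by
  the unit vector. It is used to read off the kernel when this entry is nonzero.\<close>

lemma adj_entry_eq_det:
  fixes E :: "nat \<Rightarrow> nat \<Rightarrow> 'k::comm_ring_1"
  assumes "p < n"
  shows "adj_entry n E p p = det (sq_mat n (\<lambda>i k. if k = p then of_bool (i = p) else E i k))"
proof -
  let ?F = "\<lambda>i k. if k = p then of_bool (i = p) else E i k"
  have "det (sq_mat n ?F) = (\<Sum>i<n. sq_mat n ?F $$ (i, p) * cofactor (sq_mat n ?F) i p)"
    using assms by (intro laplace_expansion_column) auto
  also have "\<dots> = (\<Sum>i<n. if i = p then cofactor (sq_mat n ?F) p p else 0)"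
    by (rule sum.cong) (auto simp: assms)
  also have "\<dots> = cofactor (sq_mat n ?F) p p"
    using assms by simp
  also have "mat_delete (sq_mat n ?F) p p = mat_delete (sq_mat n E) p p"
    unfolding mat_delete_sq_mat sq_mat_eq_iff by auto
  then have "cofactor (sq_mat n ?F) p p = cofactor (sq_mat n E) p p"
    unfolding cofactor_def by simp
  also have "\<dots> = adj_entry n E p p"
    using assms by (simp add: adj_entry_def adj_mat_def)
  finally show ?thesis ..
qed

lemma poly_fun_det:
  assumes "\<And>i j. i < n \<Longrightarrow> j < n \<Longrightarrow> poly_fun (\<lambda>t. E t i j)"
  shows "poly_fun (\<lambda>t. det (sq_mat n (E t)))"
proof -
  have "det (sq_mat n (E t)) =
      (\<Sum>\<pi> | \<pi> permutes {0..<n}. signof \<pi> * (\<Prod>i = 0..<n. E t i (\<pi> i)))" for t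
  proof -
    have "sq_mat n (E t) $$ (i, \<pi> i) = E t i (\<pi> i)" if "\<pi> permutes {0..<n}" "i < n" for \<pi> i
      using permutes_in_image[OF that(1), of i] that(2) by simp
    then show ?thesis
      unfolding det_def'[OF sq_mat_carrier] by (intro sum.cong prod.cong arg_cong2[where f = "(*)"]) auto
  qed
  then show ?thesis
    by (simp only:) (intro poly_fun_intros assms, auto simp: permutes_in_image)
qed

lemma poly_fun_adj_entry:
  assumes "\<And>i j. i < n \<Longrightarrow> j < n \<Longrightarrow> poly_fun (\<lambda>t. E t i j)" and "p < n" "q < n"
  shows "poly_fun (\<lambda>t. adj_entry n (E t) p q)"
proof -
  have "adj_entry n (E t) p q = (-1) ^ (q + p) *
      det (sq_mat (n - 1) (\<lambda>i j. E t (if i < q then i else Suc i) (if j < p then j else Suc j)))" for t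
    using assms(2,3) by (simp add: adj_entry_def adj_mat_def cofactor_def mat_delete_sq_mat)
  then show ?thesis
    by (simp only:) (intro poly_fun_mult poly_fun_const poly_fun_det assms, auto)
qed

text \<open>Let \<open>C t\<close> be the adjugate of \<open>E + t B\<close>. All these matrices being singular, \<open>C t (E + t B) = 0\<close> and
  \<open>E C 0 = 0\<close>, whence \<open>t C t B C 0 = 0\<close>. Dividing by \<open>t\<close> and letting \<open>t\<close> specialise to \<open>0\<close> gives
  \<open>C 0 B C 0 = 0\<close>, a condition that is linear in \<open>B\<close>.\<close>

lemma adj_sandwich_eq_0:
  fixes E B :: "nat \<Rightarrow> nat \<Rightarrow> 'k::field"
  assumes inf: "infinite (UNIV :: 'k set)"
    and sing: "\<And>t. det (sq_mat n (\<lambda>i j. E i j + t * B i j)) = 0"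
    and pq: "p < n" "q < n"
  shows "(\<Sum>i<n. \<Sum>j<n. adj_entry n E p i * B i j * adj_entry n E j q) = 0"
proof -
  define C where "C t = adj_entry n (\<lambda>i j. E i j + t * B i j)" for t
  define f where "f t = (\<Sum>i<n. \<Sum>j<n. C t p i * B i j * adj_entry n E j q)" for t
  have C0: "C 0 = adj_entry n E"
    by (simp add: C_def)
  have "t * f t = 0" for t
  proof -
    have "0 = (\<Sum>j<n. (\<Sum>i<n. C t p i * (E i j + t * B i j)) * adj_entry n E j q)"
    proof -
      have "(\<Sum>i<n. C t p i * (E i j + t * B i j)) = 0" if "j < n" for j
        unfolding C_def adj_entry_left[OF pq(1) that, of "\<lambda>i j. E i j + t * B i j"]
        by (simp add: sing)
      then show ?thesis
        by simp
    qed
    also have "\<dots> = (\<Sum>i<n. \<Sum>j<n. C t p i * (E i j + t * B i j) * adj_entry n E j q)"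
      by (subst sum.swap) (simp add: sum_distrib_right)
    also have "\<dots> = (\<Sum>i<n. C t p i * (\<Sum>j<n. E i j * adj_entry n E j q)) + t * f t"
      by (simp add: f_def algebra_simps sum.distrib sum_distrib_left)
    also have "(\<Sum>i<n. C t p i * (\<Sum>j<n. E i j * adj_entry n E j q)) = 0"
      using pq sing[of 0] by (intro sum.neutral) (simp add: adj_entry_right)
    finally show ?thesis by simp
  qed
  then have "f t = 0" if "t \<notin> {0}" for t
    using that by (metis mult_eq_0_iff singletonI)
  moreover have "poly_fun f"
    unfolding f_def[abs_def] C_def
    by (intro poly_fun_intros poly_fun_adj_entry pq) auto
  ultimately have "f 0 = 0"
    using poly_fun_zero_off_finite[OF inf, of f "{0}" 0] by blast
  then show ?thesis
    by (simp add: f_def C0)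
qed

text \<open>A family of linear forms on an \<open>n\<close>-dimensional space without common nontrivial zero contains
  \<open>n\<close> independent ones. The rows of the identity matrix are exchanged for members of the family one
  at a time.\<close>

lemma exists_rows_det_nonzero:
  fixes R :: "'a \<Rightarrow> nat \<Rightarrow> 'k::field"
  assumes triv: "\<And>v j. (\<And>a. a \<in> A \<Longrightarrow> (\<Sum>j<n. R a j * v j) = 0) \<Longrightarrow> j < n \<Longrightarrow> v j = 0"
  shows "\<exists>\<alpha>. (\<forall>i<n. \<alpha> i \<in> A) \<and> det (sq_mat n (\<lambda>i. R (\<alpha> i))) \<noteq> 0"
proof -
  define Q where "Q r \<alpha> i = (if i < r then R (\<alpha> i) else (\<lambda>j. of_bool (i = j)))" for r \<alpha> and i :: nat
  have "\<exists>\<alpha>. (\<forall>i<r. \<alpha> i \<in> A) \<and> det (sq_mat n (Q r \<alpha>)) \<noteq> 0" if "r \<le> n" for r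
    using that
  proof (induction r)
    case 0
    have "sq_mat n (Q 0 \<alpha>) = 1\<^sub>m n" for \<alpha>
      by (rule eq_matI) (auto simp: Q_def)
    then show ?case
      by simp
  next
    case (Suc r)
    obtain \<alpha> where \<alpha>: "\<forall>i<r. \<alpha> i \<in> A" "det (sq_mat n (Q r \<alpha>)) \<noteq> 0"
      using Suc.IH[OF Suc_leD[OF Suc.prems]] by blast
    \<comment> \<open>The vector \<open>w\<close> spans the common kernel of all rows but the one to be exchanged.\<close>
    obtain w where w: "\<And>i. i < n \<Longrightarrow> (\<Sum>j<n. Q r \<alpha> i j * w j) = of_bool (i = r)"
      using linear_system_solvable[OF \<alpha>(2), of "\<lambda>i. of_bool (i = r)"] by blast
    have "\<exists>j<n. w j \<noteq> 0"
    proof (rule ccontr)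
      assume "\<not> ?thesis"
      then show False
        using w[of r] Suc.prems by simp
    qed
    then have "\<not> (\<forall>a\<in>A. (\<Sum>j<n. R a j * w j) = 0)"
      using triv[of w] by metis
    then obtain a where a: "a \<in> A" "(\<Sum>j<n. R a j * w j) \<noteq> 0"
      by blast
    have "det (sq_mat n (Q (Suc r) (\<alpha>(r := a)))) \<noteq> 0"
    proof
      assume "det (sq_mat n (Q (Suc r) (\<alpha>(r := a)))) = 0"
      then obtain v where v: "\<exists>j<n. v j \<noteq> 0"
        and v0: "\<And>i. i < n \<Longrightarrow> (\<Sum>j<n. Q (Suc r) (\<alpha>(r := a)) i j * v j) = 0"
        unfolding det_sq_mat_eq_0_iff by blast
      define c where "c = (\<Sum>j<n. Q r \<alpha> r j * v j)"
      have "(\<Sum>j<n. Q r \<alpha> i j * (v j - c * w j)) = 0" if i: "i < n" for i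
      proof -
        have "(\<Sum>j<n. Q r \<alpha> i j * v j) = of_bool (i = r) * c"
        proof (cases "i = r")
          case False
          then have "Q (Suc r) (\<alpha>(r := a)) i = Q r \<alpha> i"
            by (auto simp: Q_def)
          then show ?thesis
            using v0[OF i] False by simp
        qed (simp add: c_def)
        moreover have "(\<Sum>j<n. Q r \<alpha> i j * (v j - c * w j)) =
            (\<Sum>j<n. Q r \<alpha> i j * v j) - c * (\<Sum>j<n. Q r \<alpha> i j * w j)"
          by (simp add: algebra_simps sum_subtractf sum_distrib_left)
        ultimately show ?thesis
          using w[OF i] by simp
      qed
      then have vw: "v j = c * w j" if "j < n" for j
        using det_nonzero_kernel_trivial[OF \<alpha>(2), of "\<lambda>j. v j - c * w j", OF _ that] by simp
      have "0 = (\<Sum>j<n. R a j * v j)"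
        using v0[of r] Suc.prems by (simp add: Q_def)
      also have "\<dots> = (\<Sum>j<n. c * (R a j * w j))"
        by (rule sum.cong) (simp_all add: vw)
      also have "\<dots> = c * (\<Sum>j<n. R a j * w j)"
        by (rule sum_distrib_left[symmetric])
      finally have "c = 0"
        using a by simp
      then show False
        using v vw by auto
    qed
    moreover have "\<forall>i<Suc r. (\<alpha>(r := a)) i \<in> A"
      using \<alpha>(1) a(1) by (simp add: less_Suc_eq)
    ultimately show ?case
      by blast
  qed
  from this[of n] obtain \<alpha> where "\<forall>i<n. \<alpha> i \<in> A" "det (sq_mat n (Q n \<alpha>)) \<noteq> 0"
    by blast
  moreover have "sq_mat n (Q n \<alpha>) = sq_mat n (\<lambda>i. R (\<alpha> i))"
    unfolding sq_mat_eq_iff by (simp add: Q_def)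
  ultimately show ?thesis
    by metis
qed

section \<open>Singular spaces from skew-symmetric forms\<close>

text \<open>An arbitrary tensor \<open>T\<close> encodes the matrices \<open>skew T k\<close> for \<open>k < N\<close>. They are alternating, with zero
  diagonal in every characteristic. Using differences instead of a choice of the entries above the
  diagonal keeps the cyclic tensor below free of signs.\<close>

definition skew :: "(nat \<times> nat \<times> nat \<Rightarrow> 'k::field) \<Rightarrow> nat \<Rightarrow> nat \<Rightarrow> nat \<Rightarrow> 'k" where
  "skew T k i j = T (k, i, j) - T (k, j, i)"

text \<open>Entry \<open>(i, k)\<close> of the matrix whose column \<open>k\<close> is \<open>skew T k\<close> applied to \<open>x\<close>.\<close>

definition col_form :: "nat \<Rightarrow> (nat \<times> nat \<times> nat \<Rightarrow> 'k::field) \<Rightarrow> (nat \<Rightarrow> 'k) \<Rightarrow> nat \<Rightarrow> nat \<Rightarrow> 'k" where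
  "col_form N T x i k = (\<Sum>j<N. skew T k i j * x j)"

text \<open>Only the values of \<open>x\<close> below \<open>N\<close> matter, so this is the image of the \<open>N\<close>-dimensional space of
  vectors.\<close>

definition skew_space :: "nat \<Rightarrow> (nat \<times> nat \<times> nat \<Rightarrow> 'k::field) \<Rightarrow> 'k mat set" where
  "skew_space N T = range (\<lambda>x. sq_mat N (col_form N T x))"

lemma skew_sum_0: "(\<Sum>i<N. \<Sum>j<N. x i * skew T k i j * x j) = 0"
proof -
  have "(\<Sum>i<N. \<Sum>j<N. x i * T (k, j, i) * x j) = (\<Sum>i<N. \<Sum>j<N. x j * T (k, i, j) * x i)"
    by (rule sum.swap)
  also have "\<dots> = (\<Sum>i<N. \<Sum>j<N. x i * T (k, i, j) * x j)"
    by (simp add: mult.commute mult.left_commute)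
  finally show ?thesis
    by (simp add: skew_def algebra_simps sum_subtractf)
qed

lemma col_form_left_kernel: "(\<Sum>i<N. x i * col_form N T x i k) = 0"
  using skew_sum_0[of x T k N] by (simp add: col_form_def sum_distrib_left mult.assoc)

lemma col_form_add: "col_form N T (\<lambda>j. x j + y j) i k = col_form N T x i k + col_form N T y i k"
  by (simp add: col_form_def algebra_simps sum.distrib)

lemma col_form_scale: "col_form N T (\<lambda>j. c * x j) i k = c * col_form N T x i k"
  by (simp add: col_form_def algebra_simps sum_distrib_left)

lemma col_form_unit:
  assumes "j < N"
  shows "col_form N T (\<lambda>l. of_bool (l = j)) i k = skew T k i j"
proof -
  have "col_form N T (\<lambda>l. of_bool (l = j)) i k = (\<Sum>l<N. if l = j then skew T k i j else 0)"
    unfolding col_form_def by (rule sum.cong) auto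
  then show ?thesis
    using assms by simp
qed

lemma det_col_form:
  assumes "N > 0"
  shows "det (sq_mat N (col_form N T x)) = 0"
proof (cases "\<exists>i<N. x i \<noteq> 0")
  case True
  then show ?thesis
    unfolding det_sq_mat_eq_0_iff_left using col_form_left_kernel by blast
next
  case False
  then have "col_form N T x i k = 0" for i k
    by (simp add: col_form_def)
  then show ?thesis
    unfolding det_sq_mat_eq_0_iff_left using assms by (intro exI[of _ "\<lambda>_. 1"]) auto
qed

lemma sq_mat_mem_skew_space: "sq_mat N (col_form N T x) \<in> skew_space N T"
  by (simp add: skew_space_def)

lemma singular_skew_space:
  assumes "N > 0"
  shows "singular_matrix_space N (skew_space N T)"
  unfolding singular_matrix_space_iff
proof (intro conjI ballI allI)
  show "skew_space N T \<subseteq> carrier_mat N N"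
    by (auto simp: skew_space_def)
  have "0\<^sub>m N N = sq_mat N (col_form N T (\<lambda>j. 0))"
    by (rule eq_matI) (auto simp: col_form_def)
  then show "0\<^sub>m N N \<in> skew_space N T"
    by (simp only: sq_mat_mem_skew_space)
  fix A assume "A \<in> skew_space N T"
  then obtain x where A: "A = sq_mat N (col_form N T x)"
    by (auto simp: skew_space_def)
  show "\<not> invertible_mat A"
    unfolding A invertible_mat_iff_det[OF sq_mat_carrier] using det_col_form[OF assms] by simp
  fix c
  have "c \<cdot>\<^sub>m A = sq_mat N (col_form N T (\<lambda>j. c * x j))"
    unfolding A by (rule eq_matI) (auto simp: col_form_scale)
  then show "c \<cdot>\<^sub>m A \<in> skew_space N T"
    by (simp only: sq_mat_mem_skew_space)
next
  fix A B assume "A \<in> skew_space N T" "B \<in> skew_space N T"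
  then obtain x y where A: "A = sq_mat N (col_form N T x)" and B: "B = sq_mat N (col_form N T y)"
    by (auto simp: skew_space_def)
  have "A + B = sq_mat N (col_form N T (\<lambda>j. x j + y j))"
    unfolding A B by (rule eq_matI) (auto simp: col_form_add)
  then show "A + B \<in> skew_space N T"
    by (simp only: sq_mat_mem_skew_space)
qed

section \<open>A criterion for maximality\<close>

text \<open>Coefficients of linear forms on matrices \<open>B\<close>. The first kind takes \<open>B\<close> to the entry \<open>(p, q)\<close> of
  \<open>C B C\<close>, where \<open>C\<close> is the adjugate of the matrix belonging to \<open>x\<close>. The second kind takes \<open>B\<close> to a
  diagonal entry.\<close>

fun functional ::
  "nat \<Rightarrow> (nat \<times> nat \<times> nat \<Rightarrow> 'k::field) \<Rightarrow> ((nat \<Rightarrow> 'k) \<times> nat \<times> nat) + nat \<Rightarrow> nat \<Rightarrow> nat \<Rightarrow> 'k" where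
  "functional N T (Inl (x, p, q)) i j =
     adj_entry N (col_form N T x) p i * adj_entry N (col_form N T x) j q"
| "functional N T (Inr k) i j = of_bool (i = k \<and> j = k)"

text \<open>The linear forms with all vectors \<open>x\<close> and all positions inside the matrix.\<close>

definition functional_indices :: "nat \<Rightarrow> (((nat \<Rightarrow> 'k) \<times> nat \<times> nat) + nat) set" where
  "functional_indices N = Inl ` (UNIV \<times> {..<N} \<times> {..<N}) \<union> Inr ` {..<N}"

lemma sum_div_mod:
  "(\<Sum>m<N * N. f (m div N) (m mod N)) = (\<Sum>i<N. \<Sum>j<N. f i j :: 'k::comm_monoid_add)" for N :: nat
proof -
  have "(\<Sum>m<N * N. f (m div N) (m mod N)) =
      (\<Sum>i<N. \<Sum>m = i * N..<i * N + N. f (m div N) (m mod N))"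
    by (rule sum.nat_group[symmetric])
  also have "\<dots> = (\<Sum>i<N. \<Sum>j<N. f i j)"
  proof (rule sum.cong[OF refl])
    fix i
    have "(\<Sum>m = i * N..<i * N + N. f (m div N) (m mod N)) =
        (\<Sum>j = 0..<N. f ((j + i * N) div N) ((j + i * N) mod N))"
      using sum.shift_bounds_nat_ivl[of "\<lambda>m. f (m div N) (m mod N)" 0 "i * N" N]
      by (simp add: add.commute)
    also have "\<dots> = (\<Sum>j<N. f i j)"
      by (rule sum.cong) auto
    finally show "(\<Sum>m = i * N..<i * N + N. f (m div N) (m mod N)) = (\<Sum>j<N. f i j)" .
  qed
  finally show ?thesis .
qed

text \<open>By the condition \<open>diag\<close>, every matrix can be made to have zero diagonal by subtracting an element of
  the space. By the condition \<open>full\<close>, no nonzero matrix with zero diagonal satisfies the adjugate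
  conditions that an enlargement of the space imposes on its elements. Positions \<open>(i, j)\<close> are
  numbered by \<open>i * N + j\<close>.\<close>

lemma maximal_skew_space:
  fixes T :: "nat \<times> nat \<times> nat \<Rightarrow> 'k::field"
  assumes inf: "infinite (UNIV :: 'k set)" and N: "N > 0"
    and diag: "det (sq_mat N (\<lambda>i j. skew T i i j)) \<noteq> 0"
    and \<alpha>: "\<And>a. a < N * N \<Longrightarrow> \<alpha> a \<in> functional_indices N"
    and full: "det (sq_mat (N * N) (\<lambda>a m. functional N T (\<alpha> a) (m div N) (m mod N))) \<noteq> 0"
  shows "maximal_singular_matrix_space N (skew_space N T)"
  unfolding maximal_singular_matrix_space_def
proof (intro conjI notI singular_skew_space[OF N])
  assume "\<exists>\<B>. singular_matrix_space N \<B> \<and> skew_space N T \<subset> \<B>"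
  then obtain \<B> A where \<B>: "singular_matrix_space N \<B>" and sub: "skew_space N T \<subseteq> \<B>"
    and A: "A \<in> \<B>" "A \<notin> skew_space N T"
    by blast
  have carrier: "\<B> \<subseteq> carrier_mat N N"
    and add: "\<And>X Y. X \<in> \<B> \<Longrightarrow> Y \<in> \<B> \<Longrightarrow> X + Y \<in> \<B>"
    and smult: "\<And>c X. X \<in> \<B> \<Longrightarrow> c \<cdot>\<^sub>m X \<in> \<B>"
    and sing: "\<And>X. X \<in> \<B> \<Longrightarrow> det X = 0"
    using \<B> invertible_mat_iff_det unfolding singular_matrix_space_iff by blast+
  have A_carrier: "A \<in> carrier_mat N N"
    using A carrier by blast
  obtain x where x: "\<And>i. i < N \<Longrightarrow> (\<Sum>j<N. skew T i i j * x j) = A $$ (i, i)"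
    using linear_system_solvable[OF diag, of "\<lambda>i. A $$ (i, i)"] by blast
  define B where "B i j = A $$ (i, j) - col_form N T x i j" for i j
  have B_mem: "sq_mat N B \<in> \<B>"
  proof -
    have "sq_mat N B = A + (- 1) \<cdot>\<^sub>m sq_mat N (col_form N T x)"
      using A_carrier by (intro eq_matI) (auto simp: B_def)
    moreover have "sq_mat N (col_form N T x) \<in> \<B>"
      using sub by (auto simp: skew_space_def)
    ultimately show ?thesis
      using add smult A(1) by simp
  qed
  have zero: "(\<Sum>i<N. \<Sum>j<N. functional N T a i j * B i j) = 0" if "a \<in> functional_indices N" for a
  proof (cases a)
    case (Inl b)
    then obtain y p q where a: "a = Inl (y, p, q)" and pq: "p < N" "q < N"
      using \<open>a \<in> functional_indices N\<close> by (auto simp: functional_indices_def)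
    have "det (sq_mat N (\<lambda>i j. col_form N T y i j + t * B i j)) = 0" for t
    proof -
      have "sq_mat N (\<lambda>i j. col_form N T y i j + t * B i j) =
          sq_mat N (col_form N T y) + t \<cdot>\<^sub>m sq_mat N B"
        by (rule eq_matI) auto
      moreover have "sq_mat N (col_form N T y) \<in> \<B>"
        using sub by (auto simp: skew_space_def)
      ultimately show ?thesis
        using add smult sing B_mem by simp
    qed
    from adj_sandwich_eq_0[OF inf this pq] show ?thesis
      by (simp add: a mult.assoc mult.commute mult.left_commute)
  next
    case (Inr k)
    then have "k < N"
      using \<open>a \<in> functional_indices N\<close> by (auto simp: functional_indices_def)
    have "(\<Sum>i<N. \<Sum>j<N. functional N T a i j * B i j) =
        (\<Sum>i<N. if i = k then \<Sum>j<N. if j = k then B k k else 0 else 0)"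
      unfolding Inr by (intro sum.cong refl) auto
    also have "\<dots> = B k k"
      using \<open>k < N\<close> by simp
    also have "\<dots> = 0"
      using x[OF \<open>k < N\<close>] by (simp add: B_def col_form_def)
    finally show ?thesis .
  qed
  have "(\<Sum>m<N * N. functional N T (\<alpha> a) (m div N) (m mod N) * B (m div N) (m mod N)) = 0"
    if "a < N * N" for a
    using zero[OF \<alpha>[OF that]] sum_div_mod[of "\<lambda>i j. functional N T (\<alpha> a) i j * B i j" N] by simp
  then have B0: "B (m div N) (m mod N) = 0" if "m < N * N" for m
    using det_nonzero_kernel_trivial[OF full, of "\<lambda>m. B (m div N) (m mod N)", OF _ that] by blast
  have "B i j = 0" if "i < N" "j < N" for i j
  proof -
    have "i * N + j < Suc i * N"
      using that by simp
    also have "\<dots> \<le> N * N"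
      using that by (intro mult_le_mono1) simp
    finally have "i * N + j < N * N" .
    moreover have "(i * N + j) div N = i" "(i * N + j) mod N = j"
      using that by auto
    ultimately show ?thesis
      using B0[of "i * N + j"] by simp
  qed
  then have "A = sq_mat N (col_form N T x)"
    using A_carrier by (intro eq_matI) (auto simp: B_def)
  then show False
    using A(2) by (auto simp: skew_space_def)
qed

section \<open>The cyclic tensor\<close>

text \<open>The successor on the cycle of indices below \<open>N\<close>.\<close>

definition cyc :: "nat \<Rightarrow> nat \<Rightarrow> nat" where
  "cyc N k = Suc k mod N"

text \<open>The tensor whose matrix with number \<open>k\<close> is the exterior product of the basis vectors \<open>k\<close> and
  \<open>cyc N k\<close>. Column \<open>k\<close> of the matrix belonging to \<open>x\<close> then has only the two nonzero entries
  \<open>x (cyc N k)\<close> in row \<open>k\<close> and \<open>- x k\<close> in row \<open>cyc N k\<close>.\<close>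

definition cyclic_tensor :: "nat \<Rightarrow> nat \<times> nat \<times> nat \<Rightarrow> 'k::field" where
  "cyclic_tensor N = (\<lambda>(k, i, j). of_bool (i = k \<and> j = cyc N k))"

lemma cyc_less: "N > 0 \<Longrightarrow> cyc N k < N"
  by (simp add: cyc_def)

lemma cyc_neq: "N \<ge> 2 \<Longrightarrow> k < N \<Longrightarrow> cyc N k \<noteq> k"
  by (cases "Suc k = N") (auto simp: cyc_def)

lemma cyc_cyc_neq: "N \<ge> 3 \<Longrightarrow> k < N \<Longrightarrow> cyc N (cyc N k) \<noteq> k"
  by (cases "Suc k = N"; cases "Suc (Suc k) = N") (auto simp: cyc_def)

lemma cyc_inj: "k < N \<Longrightarrow> l < N \<Longrightarrow> cyc N k = cyc N l \<longleftrightarrow> k = l"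
  by (cases "Suc k = N"; cases "Suc l = N") (auto simp: cyc_def)

lemma cyc_surj:
  assumes "i < N"
  shows "\<exists>k<N. cyc N k = i"
proof (cases i)
  case 0
  then show ?thesis
    using assms by (intro exI[of _ "N - 1"]) (auto simp: cyc_def)
next
  case (Suc l)
  then show ?thesis
    using assms by (intro exI[of _ l]) (auto simp: cyc_def)
qed

lemma cyc_invariant_const:
  assumes "\<And>k. k < N \<Longrightarrow> f (cyc N k) = f k" and "k < N"
  shows "f k = f 0"
  using assms(2)
proof (induction k)
  case (Suc k)
  then have "cyc N k = Suc k"
    by (simp add: cyc_def)
  then show ?case
    using assms(1)[of k] Suc by simp
qed simp

lemma col_form_cyclic:
  assumes "N > 0" "k < N"
  shows "col_form N (cyclic_tensor N) x i k =
    of_bool (i = k) * x (cyc N k) - of_bool (i = cyc N k) * x k"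
proof -
  have "col_form N (cyclic_tensor N) x i k =
      (\<Sum>j<N. (if j = cyc N k then of_bool (i = k) * x (cyc N k) else 0) -
        (if j = k then of_bool (i = cyc N k) * x k else 0))"
    unfolding col_form_def skew_def cyclic_tensor_def by (rule sum.cong) (auto simp: algebra_simps)
  also have "\<dots> = of_bool (i = k) * x (cyc N k) - of_bool (i = cyc N k) * x k"
    using assms cyc_less[of N k] unfolding sum_subtractf by simp
  finally show ?thesis .
qed

lemma sum_two_terms:
  fixes f :: "nat \<Rightarrow> 'k::comm_ring_1"
  assumes "p < N" "q < N"
  shows "(\<Sum>i<N. f i * (of_bool (i = p) * a - of_bool (i = q) * b)) = f p * a - f q * b"
proof -
  have "(\<Sum>i<N. f i * (of_bool (i = p) * a - of_bool (i = q) * b)) =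
      (\<Sum>i<N. (if i = p then f p * a else 0) - (if i = q then f q * b else 0))"
    by (rule sum.cong) (auto simp: algebra_simps)
  then show ?thesis
    using assms by (simp add: sum_subtractf)
qed

lemma cyclic_left_sum:
  assumes "N > 0" "k < N"
  shows "(\<Sum>i<N. y i * col_form N (cyclic_tensor N) x i k) = y k * x (cyc N k) - y (cyc N k) * x k"
  unfolding col_form_cyclic[OF assms] using sum_two_terms[OF assms(2) cyc_less[OF assms(1)]] .

lemma cyclic_right_sum:
  assumes "N > 0" "l < N"
  shows "(\<Sum>k<N. col_form N (cyclic_tensor N) x (cyc N l) k * y k) =
    x (cyc N (cyc N l)) * y (cyc N l) - x l * y l"
proof -
  have "(\<Sum>k<N. col_form N (cyclic_tensor N) x (cyc N l) k * y k) =
      (\<Sum>k<N. (x (cyc N k) * y k) * (of_bool (k = cyc N l) * 1 - of_bool (k = l) * 0) -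
        (x k * y k) * (of_bool (k = l) * 1 - of_bool (k = cyc N l) * 0))"
  proof (rule sum.cong)
    fix k assume "k \<in> {..<N}"
    then have k: "k < N"
      by simp
    show "col_form N (cyclic_tensor N) x (cyc N l) k * y k =
      (x (cyc N k) * y k) * (of_bool (k = cyc N l) * 1 - of_bool (k = l) * 0) -
        (x k * y k) * (of_bool (k = l) * 1 - of_bool (k = cyc N l) * 0)"
      unfolding col_form_cyclic[OF assms(1) k] using cyc_inj[OF k assms(2)] by auto
  qed simp
  also have "\<dots> = x (cyc N (cyc N l)) * y (cyc N l) - x l * y l"
    unfolding sum_subtractf sum_two_terms[OF cyc_less[OF assms(1)] assms(2)]
      sum_two_terms[OF assms(2) cyc_less[OF assms(1)]]
    by simp
  finally show ?thesis .
qed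

lemma cyclic_diag_det:
  assumes "N \<ge> 2"
  shows "det (sq_mat N (\<lambda>i j. skew (cyclic_tensor N :: _ \<Rightarrow> 'k::field) i i j)) \<noteq> 0"
proof
  let ?T = "cyclic_tensor N :: _ \<Rightarrow> 'k"
  assume "det (sq_mat N (\<lambda>i j. skew ?T i i j)) = 0"
  then obtain v where v: "\<exists>j<N. v j \<noteq> 0"
    and v0: "\<And>i. i < N \<Longrightarrow> (\<Sum>j<N. skew ?T i i j * v j) = 0"
    unfolding det_sq_mat_eq_0_iff by blast
  have "v (cyc N k) = 0" if "k < N" for k
  proof -
    have "col_form N ?T v k k = 0"
      using v0[OF that] by (simp add: col_form_def)
    then show ?thesis
      using assms that cyc_neq[OF assms that] by (simp add: col_form_cyclic)
  qed
  then show False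
    using v cyc_surj by metis
qed

lemma cyclic_adj_entry_nonzero:
  assumes N: "N > 0" and x: "\<And>j. x j \<noteq> (0 :: 'k::field)"
  shows "adj_entry N (col_form N (cyclic_tensor N) x) (N - 1) (N - 1) \<noteq> 0"
proof
  let ?M = "col_form N (cyclic_tensor N) x"
  have p: "N - 1 < N"
    using N by simp
  assume "adj_entry N ?M (N - 1) (N - 1) = 0"
  then obtain v where v: "\<exists>i<N. v i \<noteq> 0"
    and v0: "\<And>k. k < N \<Longrightarrow>
      (\<Sum>i<N. v i * (if k = N - 1 then of_bool (i = N - 1) else ?M i k)) = 0"
    unfolding adj_entry_eq_det[OF p] det_sq_mat_eq_0_iff_left by blast
  have last: "v (N - 1) = 0"
  proof -
    have "(\<Sum>i<N. v i * of_bool (i = N - 1)) = (\<Sum>i<N. if i = N - 1 then v (N - 1) else 0)"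
      by (rule sum.cong) auto
    then show ?thesis
      using v0[OF p] p by simp
  qed
  have "v (N - 1 - d) = 0" for d
  proof (induction d)
    case 0
    then show ?case using last by simp
  next
    case (Suc d)
    show ?case
    proof (cases "d < N - 1")
      case False
      then show ?thesis using Suc by simp
    next
      case True
      define k where "k = N - 1 - Suc d"
      have k: "k < N" "k \<noteq> N - 1" "cyc N k = N - 1 - d"
        using True by (auto simp: k_def cyc_def)
      have "v k * x (cyc N k) - v (cyc N k) * x k = 0"
        using v0[OF k(1)] k(2) cyclic_left_sum[OF N k(1), of v x] by simp
      then have "v k = 0"
        using Suc k(3) x by simp
      then show ?thesis
        by (simp add: k_def)
    qed
  qed
  from this[of "N - 1 - i" for i] have "v i = 0" if "i < N" for i
    using that by (metis Suc_pred' diff_diff_cancel less_Suc_eq_le N)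
  then show False
    using v by blast
qed

text \<open>The left kernel is spanned by \<open>x\<close> and the right kernel by the vector with entries
  \<open>1 / (x k * x (cyc N k))\<close>, as both kernel equations are recursions along the cycle. Hence the
  adjugate is a multiple of the product of these vectors.\<close>

lemma cyclic_adj_entry:
  fixes x :: "nat \<Rightarrow> 'k::field"
  assumes N: "N > 0" and x: "\<And>j. x j \<noteq> 0"
  shows "\<exists>\<nu>. \<nu> \<noteq> 0 \<and> (\<forall>k<N. \<forall>i<N.
    adj_entry N (col_form N (cyclic_tensor N) x) k i = \<nu> * x i / (x k * x (cyc N k)))"
proof -
  let ?M = "col_form N (cyclic_tensor N) x"
  define a where "a = adj_entry N ?M"
  have det: "det (sq_mat N ?M) = 0"
    by (rule det_col_form[OF N])
  have row: "a r i / x i = a r 0 / x 0" if "r < N" "i < N" for r i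
  proof (rule cyc_invariant_const[of N "\<lambda>i. a r i / x i"])
    fix k assume k: "k < N"
    have "(\<Sum>i<N. a r i * ?M i k) = 0"
      unfolding a_def adj_entry_left[OF that(1) k] det by simp
    then show "a r (cyc N k) / x (cyc N k) = a r k / x k"
      unfolding cyclic_left_sum[OF N k] using x by (simp add: field_simps)
  qed (fact that)
  have col: "a k i * (x k * x (cyc N k)) = a 0 i * (x 0 * x (cyc N 0))" if "k < N" "i < N" for k i
  proof (rule cyc_invariant_const[of N "\<lambda>k. a k i * (x k * x (cyc N k))"])
    fix l assume l: "l < N"
    have "(\<Sum>k<N. ?M (cyc N l) k * a k i) = 0"
      unfolding a_def adj_entry_right[OF cyc_less[OF N] that(2)] det by simp
    then show "a (cyc N l) i * (x (cyc N l) * x (cyc N (cyc N l))) = a l i * (x l * x (cyc N l))"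
      unfolding cyclic_right_sum[OF N l] by (simp add: algebra_simps)
  qed (fact that)
  define \<nu> where "\<nu> = a 0 0 / x 0 * (x 0 * x (cyc N 0))"
  have eq: "a k i = \<nu> * x i / (x k * x (cyc N k))" if "k < N" "i < N" for k i
  proof -
    have "a k i * (x k * x (cyc N k)) = a 0 i * (x 0 * x (cyc N 0))"
      by (rule col[OF that])
    also have "a 0 i = a 0 0 / x 0 * x i"
      using row[OF N that(2)] x[of i] by (simp add: field_simps)
    finally have "a k i * (x k * x (cyc N k)) = \<nu> * x i"
      by (simp add: \<nu>_def mult.commute mult.left_commute)
    then show ?thesis
      using x by (simp add: field_simps)
  qed
  moreover have "\<nu> \<noteq> 0"
  proof
    assume "\<nu> = 0"
    then have "a (N - 1) (N - 1) = 0"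
      using eq[of "N - 1" "N - 1"] N by simp
    then show False
      using cyclic_adj_entry_nonzero[of N x, OF N x] by (simp add: a_def)
  qed
  ultimately show ?thesis
    unfolding a_def by blast
qed

text \<open>The exponents of \<open>x i / (x j * x (cyc N j))\<close> times the product of all variables. For \<open>i \<noteq> j\<close> the
  truncated subtraction is exact.\<close>

definition cyclic_exponent :: "nat \<Rightarrow> nat \<times> nat \<Rightarrow> nat \<Rightarrow> nat" where
  "cyclic_exponent N = (\<lambda>(i, j) l. 1 + of_bool (l = i) - (of_bool (l = j) + of_bool (l = cyc N j)))"

lemma prod_cyclic_exponent:
  fixes x :: "nat \<Rightarrow> 'k::field"
  assumes N: "N \<ge> 2" and ij: "i < N" "j < N" "i \<noteq> j" and x: "\<And>j. x j \<noteq> 0"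
  shows "(\<Prod>l<N. x l ^ cyclic_exponent N (i, j) l) = (\<Prod>l<N. x l) * (x i / (x j * x (cyc N j)))"
proof -
  have delta: "(\<Prod>l<N. x l ^ of_bool (l = m)) = x m" if "m < N" for m
  proof -
    have "(\<Prod>l<N. x l ^ of_bool (l = m)) = (\<Prod>l<N. if l = m then x m else 1)"
      by (rule prod.cong) auto
    then show ?thesis
      using that by simp
  qed
  have c: "cyc N j < N" "cyc N j \<noteq> j"
    using N ij cyc_less cyc_neq by auto
  have "(\<Prod>l<N. x l ^ cyclic_exponent N (i, j) l) * (x j * x (cyc N j)) =
      (\<Prod>l<N. x l ^ cyclic_exponent N (i, j) l * (x l ^ of_bool (l = j) * x l ^ of_bool (l = cyc N j)))"
    unfolding prod.distrib delta[OF ij(2)] delta[OF c(1)] ..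
  also have "\<dots> = (\<Prod>l<N. x l * x l ^ of_bool (l = i))"
    using c(2) ij(3) by (intro prod.cong refl) (auto simp: cyclic_exponent_def)
  also have "\<dots> = (\<Prod>l<N. x l) * x i"
    unfolding prod.distrib delta[OF ij(1)] ..
  finally show ?thesis
    using x by (simp add: field_simps)
qed

lemma inj_cyclic_exponent:
  assumes N: "N \<ge> 3"
  shows "inj_on (\<lambda>e. restrict (cyclic_exponent N e) {..<N}) {(i, j). i < N \<and> j < N \<and> i \<noteq> j}"
proof (rule inj_onI, clarify)
  fix i j i' j' assume ij: "i < N" "j < N" "i \<noteq> j" and ij': "i' < N" "j' < N" "i' \<noteq> j'"
    and "restrict (cyclic_exponent N (i, j)) {..<N} = restrict (cyclic_exponent N (i', j')) {..<N}"
  then have eq: "cyclic_exponent N (i, j) l = cyclic_exponent N (i', j') l" if "l < N" for l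
    using that by (metis lessThan_iff restrict_apply')
  have "j = j'"
  proof (rule ccontr)
    assume "j \<noteq> j'"
    have "cyclic_exponent N (i', j') j = 0"
      using eq[OF ij(2)] ij(3) by (simp add: cyclic_exponent_def)
    then have "j = cyc N j'"
      using \<open>j \<noteq> j'\<close> by (auto simp: cyclic_exponent_def of_bool_def split: if_splits)
    have "cyclic_exponent N (i, j) j' = 0"
      using eq[OF ij'(2)] ij'(3) by (simp add: cyclic_exponent_def)
    then have "j' = cyc N j"
      using \<open>j \<noteq> j'\<close> by (auto simp: cyclic_exponent_def of_bool_def split: if_splits)
    then show False
      using \<open>j = cyc N j'\<close> cyc_cyc_neq[OF N ij(2)] by simp
  qed
  moreover have "i = i'"
    using eq[OF ij(1)] ij(3) cyc_neq[of N j] N ij(2) unfolding \<open>j = j'\<close>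
    by (auto simp: cyclic_exponent_def of_bool_def split: if_splits)
  ultimately show "i = i' \<and> j = j'"
    by simp
qed

text \<open>For the cyclic tensor, the adjugate conditions on \<open>B\<close> say that the sum of the terms
  \<open>B i j * x i / (x j * x (cyc N j))\<close> vanishes. The terms with \<open>i \<noteq> j\<close> belong to distinct monomials.\<close>

lemma cyclic_functionals_separate:
  fixes B :: "nat \<Rightarrow> nat \<Rightarrow> 'k::field"
  assumes inf: "infinite (UNIV :: 'k set)" and N: "N \<ge> 3"
    and zero: "\<And>a. a \<in> functional_indices N \<Longrightarrow>
      (\<Sum>i<N. \<Sum>j<N. functional N (cyclic_tensor N) a i j * B i j) = 0"
    and ij: "i < N" "j < N"
  shows "B i j = 0"
proof -
  have diag: "B k k = 0" if "k < N" for k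
  proof -
    have "(\<Sum>i<N. \<Sum>j<N. functional N (cyclic_tensor N) (Inr k) i j * B i j) =
        (\<Sum>i<N. if i = k then \<Sum>j<N. if j = k then B k k else 0 else 0)"
      by (intro sum.cong refl) auto
    also have "\<dots> = B k k"
      using that by simp
    finally show ?thesis
      using zero[of "Inr k"] that by (simp add: functional_indices_def)
  qed
  define P where "P = {(i, j). i < N \<and> j < N \<and> i \<noteq> j}"
  have P: "P \<subseteq> {..<N} \<times> {..<N}" "finite P"
    by (auto simp: P_def intro: finite_subset[of _ "{..<N} \<times> {..<N}"])
  have "(\<Sum>e\<in>P. (case e of (i, j) \<Rightarrow> B i j) * (\<Prod>l\<in>{..<N}. x l ^ cyclic_exponent N e l)) = 0"
    if x: "\<And>j. x j \<noteq> 0" for x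
  proof -
    obtain \<nu> where \<nu>: "\<nu> \<noteq> 0" and adj: "\<And>k i. k < N \<Longrightarrow> i < N \<Longrightarrow>
        adj_entry N (col_form N (cyclic_tensor N) x) k i = \<nu> * x i / (x k * x (cyc N k))"
      using cyclic_adj_entry[of N x, OF _ x] N by auto
    define r where "r = \<nu> * \<nu> / x (cyc N 0)"
    have "0 = (\<Sum>i<N. \<Sum>j<N. functional N (cyclic_tensor N) (Inl (x, 0, 0)) i j * B i j)"
      using zero[of "Inl (x, 0, 0)"] N by (simp add: functional_indices_def)
    also have "\<dots> = (\<Sum>i<N. \<Sum>j<N. r * (B i j * (x i / (x j * x (cyc N j)))))"
      using N x by (intro sum.cong refl) (auto simp: adj r_def field_simps)
    also have "\<dots> = r * (\<Sum>i<N. \<Sum>j<N. B i j * (x i / (x j * x (cyc N j))))"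
      by (simp add: sum_distrib_left)
    finally have "(\<Sum>i<N. \<Sum>j<N. B i j * (x i / (x j * x (cyc N j)))) = 0"
      using \<nu> x by (simp add: r_def)
    then have "0 = (\<Sum>(i, j)\<in>{..<N} \<times> {..<N}. B i j * (x i / (x j * x (cyc N j))))"
      by (simp add: sum.cartesian_product)
    also have "\<dots> = (\<Sum>(i, j)\<in>P. B i j * (x i / (x j * x (cyc N j))))"
      using P diag by (intro sum.mono_neutral_right) (auto simp: P_def)
    finally have "0 = (\<Prod>l<N. x l) * (\<Sum>(i, j)\<in>P. B i j * (x i / (x j * x (cyc N j))))"
      by simp
    also have "\<dots> = (\<Sum>(i, j)\<in>P. B i j * ((\<Prod>l<N. x l) * (x i / (x j * x (cyc N j)))))"
      by (simp add: sum_distrib_left case_prod_unfold mult.left_commute)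
    also have "\<dots> = (\<Sum>e\<in>P. (case e of (i, j) \<Rightarrow> B i j) * (\<Prod>l\<in>{..<N}. x l ^ cyclic_exponent N e l))"
      using N prod_cyclic_exponent[of N _ _ x, OF _ _ _ _ x] by (intro sum.cong refl) (auto simp: P_def)
    finally show ?thesis ..
  qed
  from monomials_independent[OF inf finite_lessThan P(2) inj_cyclic_exponent[OF N, folded P_def] this]
  have "B i j = 0" if "i \<noteq> j"
    using that ij by (fastforce simp: P_def)
  then show ?thesis
    using diag ij by blast
qed

lemma cyclic_functionals_full:
  assumes inf: "infinite (UNIV :: 'k::field set)" and N: "N \<ge> 3"
  shows "\<exists>\<alpha>. (\<forall>a<N * N. \<alpha> a \<in> functional_indices N) \<and>
    det (sq_mat (N * N) (\<lambda>a m. functional N (cyclic_tensor N :: _ \<Rightarrow> 'k) (\<alpha> a) (m div N) (m mod N))) \<noteq> 0"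
proof (rule exists_rows_det_nonzero[where R =
      "\<lambda>a m. functional N (cyclic_tensor N :: _ \<Rightarrow> 'k) a (m div N) (m mod N)"])
  fix v :: "nat \<Rightarrow> 'k" and m
  assume v: "\<And>a. a \<in> functional_indices N \<Longrightarrow>
      (\<Sum>m<N * N. functional N (cyclic_tensor N) a (m div N) (m mod N) * v m) = 0"
    and m: "m < N * N"
  define B where "B i j = v (i * N + j)" for i j
  have v_eq: "v m = B (m div N) (m mod N)" for m
    by (simp add: B_def)
  have "(\<Sum>i<N. \<Sum>j<N. functional N (cyclic_tensor N) a i j * B i j) = 0"
    if "a \<in> functional_indices N" for a
    using v[OF that] sum_div_mod[of "\<lambda>i j. functional N (cyclic_tensor N) a i j * B i j" N]
    by (simp add: v_eq)
  from cyclic_functionals_separate[OF inf N this, of "m div N" "m mod N"]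
  show "v m = 0"
    using m N by (simp add: v_eq less_mult_imp_div_less)
qed

section \<open>Conjugate spaces come from equivalent tensors\<close>

text \<open>The minor obtained by deleting the last row and column. If it is nonzero, every vector in the
  left kernel of the matrix belonging to \<open>x\<close> is collinear with \<open>x\<close>.\<close>

definition corner_minor :: "nat \<Rightarrow> (nat \<times> nat \<times> nat \<Rightarrow> 'k::field) \<Rightarrow> (nat \<Rightarrow> 'k) \<Rightarrow> 'k" where
  "corner_minor N T x = adj_entry N (col_form N T x) (N - 1) (N - 1)"

lemma corner_minor_left_kernel:
  fixes T :: "nat \<times> nat \<times> nat \<Rightarrow> 'k::field"
  assumes N: "N > 0" and nz: "corner_minor N T x \<noteq> 0"
    and y: "\<And>k. k < N \<Longrightarrow> (\<Sum>i<N. y i * col_form N T x i k) = 0" and i: "i < N"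
  shows "x (N - 1) * y i = y (N - 1) * x i"
proof -
  define p where "p = N - 1"
  have p: "p < N"
    using N by (simp add: p_def)
  define E where "E = (\<lambda>i k. if k = p then of_bool (i = p) else col_form N T x i k)"
  define u where "u i = x p * y i - y p * x i" for i
  have "det (sq_mat N E) \<noteq> 0"
    using nz unfolding corner_minor_def p_def[symmetric] adj_entry_eq_det[OF p] E_def .
  moreover have "(\<Sum>i<N. u i * E i k) = 0" if k: "k < N" for k
  proof (cases "k = p")
    case True
    have "(\<Sum>i<N. u i * E i k) = (\<Sum>i<N. if i = p then u p else 0)"
      unfolding E_def True by (rule sum.cong) auto
    then show ?thesis
      using p by (simp add: u_def)
  next
    case False
    have "(\<Sum>i<N. u i * E i k) =
        x p * (\<Sum>i<N. y i * col_form N T x i k) - y p * (\<Sum>i<N. x i * col_form N T x i k)"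
      using False by (simp add: E_def u_def sum_distrib_left sum_subtractf left_diff_distrib mult.assoc)
    then show ?thesis
      unfolding y[OF k] col_form_left_kernel by simp
  qed
  ultimately have "u i = 0"
    using i by (rule det_nonzero_left_kernel_trivial)
  then show ?thesis
    by (simp add: u_def p_def)
qed

lemma line_poly_corner_minor: "N > 0 \<Longrightarrow> line_poly (corner_minor N T)"
  unfolding line_poly_def corner_minor_def col_form_def
  by (intro allI poly_fun_adj_entry poly_fun_intros) auto

text \<open>Coordinate \<open>(k, i, j)\<close> of the transformed tensor. The matrix \<open>G\<close> acts on both indices of the
  alternating matrices, as a congruence, and \<open>H\<close> recombines these matrices.\<close>

definition tensor_action ::
  "nat \<Rightarrow> (nat \<Rightarrow> nat \<Rightarrow> 'k::field) \<Rightarrow> (nat \<Rightarrow> nat \<Rightarrow> 'k) \<Rightarrow> (nat \<times> nat \<times> nat \<Rightarrow> 'k) \<Rightarrow>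
    nat \<Rightarrow> nat \<Rightarrow> nat \<Rightarrow> 'k" where
  "tensor_action N G H T k i j = (\<Sum>a<N. \<Sum>b<N. \<Sum>l<N. G i a * G j l * H b k * skew T b a l)"

text \<open>A conjugation takes the matrix of \<open>P x\<close> to the matrix of \<open>x\<close> for a linear map \<open>P\<close>. For
  general \<open>x\<close> the left kernel of the latter is spanned by \<open>x\<close>. It contains \<open>P x\<close> transformed by the
  inverse transpose of \<open>g\<close>, so that \<open>P\<close> is a multiple of the transpose of \<open>g\<close>: a
  conjugation of spaces is an equivalence of tensors under two instead of three matrices. The
  remaining scalar freedom is used to turn one entry of \<open>G\<close> into \<open>1\<close>.\<close>

lemma conjugate_skew_spaces:
  fixes T T' :: "nat \<times> nat \<times> nat \<Rightarrow> 'k::field"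
  assumes inf: "infinite (UNIV :: 'k set)" and N: "N > 0"
    and conj: "conjugate_matrix_spaces N (skew_space N T) (skew_space N T')"
    and rigid: "corner_minor N T' x0 \<noteq> 0"
  shows "\<exists>G H r s. r < N \<and> s < N \<and> G r s = 1 \<and>
    (\<forall>k<N. \<forall>i<N. \<forall>j<N. skew T' k i j = tensor_action N G H T k i j)"
proof -
  obtain g g' h h' where c: "g \<in> carrier_mat N N" "g' \<in> carrier_mat N N"
      "h \<in> carrier_mat N N" "h' \<in> carrier_mat N N"
    and inv: "g * g' = 1\<^sub>m N" "g' * g = 1\<^sub>m N"
    and img: "skew_space N T' = (\<lambda>A. g * A * h') ` skew_space N T"
    using conj unfolding conjugate_matrix_spaces_iff by blast
  have gg': "(\<Sum>i<N. g $$ (a, i) * g' $$ (i, b)) = of_bool (a = b)" if "a < N" "b < N" for a b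
    unfolding index_mult_mat_sum[OF c(1,2) that, symmetric] inv using that by simp
  have g'g: "(\<Sum>i<N. g' $$ (a, i) * g $$ (i, b)) = of_bool (a = b)" if "a < N" "b < N" for a b
    unfolding index_mult_mat_sum[OF c(2,1) that, symmetric] inv using that by simp
  have "\<exists>z. \<forall>i<N. \<forall>k<N. skew T' k i j =
      (\<Sum>a<N. \<Sum>b<N. g $$ (i, a) * col_form N T z a b * h' $$ (b, k))" if j: "j < N" for j
  proof -
    have "sq_mat N (col_form N T' (\<lambda>l. of_bool (l = j))) \<in> (\<lambda>A. g * A * h') ` skew_space N T"
      unfolding img[symmetric] by (rule sq_mat_mem_skew_space)
    then obtain z where z: "sq_mat N (col_form N T' (\<lambda>l. of_bool (l = j))) =
        g * sq_mat N (col_form N T z) * h'"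
      by (auto simp: skew_space_def)
    have "skew T' k i j = (\<Sum>a<N. \<Sum>b<N. g $$ (i, a) * col_form N T z a b * h' $$ (b, k))"
      if i: "i < N" and k: "k < N" for i k
    proof -
      have "skew T' k i j = sq_mat N (col_form N T' (\<lambda>l. of_bool (l = j))) $$ (i, k)"
        using i k by (simp add: col_form_unit[OF j])
      also have "\<dots> = (\<Sum>b<N. (\<Sum>a<N. g $$ (i, a) * col_form N T z a b) * h' $$ (b, k))"
        unfolding z index_mult_mat_sum[OF mult_carrier_mat[OF c(1) sq_mat_carrier] c(4) i k]
        by (intro sum.cong refl arg_cong2[where f = "(*)"])
          (simp add: index_mult_mat_sum[OF c(1) sq_mat_carrier i])
      also have "\<dots> = (\<Sum>a<N. \<Sum>b<N. g $$ (i, a) * col_form N T z a b * h' $$ (b, k))"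
        by (subst sum.swap) (simp add: sum_distrib_right)
      finally show ?thesis .
    qed
    then show ?thesis
      by blast
  qed
  then have "\<forall>j\<in>{..<N}. \<exists>z. \<forall>i<N. \<forall>k<N. skew T' k i j =
      (\<Sum>a<N. \<Sum>b<N. g $$ (i, a) * col_form N T z a b * h' $$ (b, k))"
    by (simp only: lessThan_iff Ball_def) blast
  from bchoice[OF this] obtain z where z: "\<And>j i k. j < N \<Longrightarrow> i < N \<Longrightarrow> k < N \<Longrightarrow>
      skew T' k i j = (\<Sum>a<N. \<Sum>b<N. g $$ (i, a) * col_form N T (z j) a b * h' $$ (b, k))"
    by auto
  \<comment> \<open>\<open>P\<close> is the linear extension of the choice of \<open>z j\<close> for the unit vector with index \<open>j\<close>.\<close>
  define P where "P x l = (\<Sum>j<N. z j l * x j)" for x l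
  have col_P: "(\<Sum>j<N. col_form N T (z j) a b * x j) = col_form N T (P x) a b" for x a b
  proof -
    have "(\<Sum>j<N. col_form N T (z j) a b * x j) = (\<Sum>j<N. \<Sum>l<N. skew T b a l * z j l * x j)"
      by (simp add: col_form_def sum_distrib_right)
    also have "\<dots> = (\<Sum>l<N. \<Sum>j<N. skew T b a l * z j l * x j)"
      by (rule sum.swap)
    also have "\<dots> = col_form N T (P x) a b"
      by (simp add: col_form_def P_def sum_distrib_left mult.assoc)
    finally show ?thesis .
  qed
  have T'_eq: "col_form N T' x i k = (\<Sum>a<N. \<Sum>b<N. g $$ (i, a) * col_form N T (P x) a b * h' $$ (b, k))"
    if "i < N" "k < N" for x i k
  proof -
    have "col_form N T' x i k =
        (\<Sum>j<N. \<Sum>a<N. \<Sum>b<N. g $$ (i, a) * col_form N T (z j) a b * h' $$ (b, k) * x j)"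
      unfolding col_form_def[of N T'] using that by (simp add: z sum_distrib_right)
    also have "\<dots> = (\<Sum>a<N. \<Sum>j<N. \<Sum>b<N. g $$ (i, a) * col_form N T (z j) a b * h' $$ (b, k) * x j)"
      by (rule sum.swap)
    also have "\<dots> = (\<Sum>a<N. \<Sum>b<N. \<Sum>j<N. g $$ (i, a) * col_form N T (z j) a b * h' $$ (b, k) * x j)"
      by (intro sum.cong refl sum.swap)
    also have "\<dots> = (\<Sum>a<N. \<Sum>b<N. g $$ (i, a) * (\<Sum>j<N. col_form N T (z j) a b * x j) * h' $$ (b, k))"
      by (intro sum.cong refl) (simp add: sum_distrib_left sum_distrib_right mult_ac)
    finally show ?thesis
      unfolding col_P .
  qed
  define y where "y x i = (\<Sum>a<N. P x a * g' $$ (a, i))" for x i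
  have y_g: "(\<Sum>i<N. y x i * g $$ (i, b)) = P x b" if "b < N" for x b
  proof -
    have "(\<Sum>i<N. y x i * g $$ (i, b)) = (\<Sum>i<N. \<Sum>a<N. P x a * (g' $$ (a, i) * g $$ (i, b)))"
      by (simp add: y_def sum_distrib_right mult.assoc)
    also have "\<dots> = (\<Sum>a<N. P x a * (\<Sum>i<N. g' $$ (a, i) * g $$ (i, b)))"
      by (subst sum.swap) (simp add: sum_distrib_left)
    also have "\<dots> = (\<Sum>a<N. if a = b then P x b else 0)"
      by (rule sum.cong) (auto simp: g'g that)
    finally show ?thesis
      using that by simp
  qed
  have y_kernel: "(\<Sum>i<N. y x i * col_form N T' x i k) = 0" if k: "k < N" for x k
  proof -
    have "(\<Sum>i<N. y x i * col_form N T' x i k) =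
        (\<Sum>i<N. \<Sum>a<N. \<Sum>b<N. y x i * g $$ (i, a) * (col_form N T (P x) a b * h' $$ (b, k)))"
      using k by (simp add: T'_eq sum_distrib_left mult.assoc)
    also have "\<dots> = (\<Sum>a<N. \<Sum>i<N. \<Sum>b<N. y x i * g $$ (i, a) * (col_form N T (P x) a b * h' $$ (b, k)))"
      by (rule sum.swap)
    also have "\<dots> = (\<Sum>a<N. \<Sum>b<N. \<Sum>i<N. y x i * g $$ (i, a) * (col_form N T (P x) a b * h' $$ (b, k)))"
      by (intro sum.cong refl sum.swap)
    also have "\<dots> = (\<Sum>a<N. \<Sum>b<N. P x a * (col_form N T (P x) a b * h' $$ (b, k)))"
      by (intro sum.cong refl) (simp add: sum_distrib_right[symmetric] y_g)
    also have "\<dots> = (\<Sum>b<N. \<Sum>a<N. P x a * col_form N T (P x) a b * h' $$ (b, k))"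
      by (subst sum.swap) (simp add: mult.assoc)
    also have "\<dots> = (\<Sum>b<N. (\<Sum>a<N. P x a * col_form N T (P x) a b) * h' $$ (b, k))"
      by (simp add: sum_distrib_right)
    also have "\<dots> = 0"
      by (simp add: col_form_left_kernel)
    finally show ?thesis .
  qed
  define p where "p = N - 1"
  have p: "p < N"
    using N by (simp add: p_def)
  have collinear: "x p * y x i = y x p * x i" if i: "i < N" for x i
  proof -
    have lin: "poly_fun (\<lambda>s. y (\<lambda>j. u j + s * v j) i)" for u v i
      unfolding y_def P_def by (intro poly_fun_intros)
    have "line_poly (\<lambda>x. x p * y x i - y x p * x i)"
      unfolding line_poly_def by (intro allI poly_fun_intros lin)
    moreover have "x p * y x i - y x p * x i = 0" if "corner_minor N T' x \<noteq> 0" for x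
      using corner_minor_left_kernel[OF N that y_kernel i] by (simp add: p_def)
    ultimately have "x p * y x i - y x p * x i = 0"
      by (rule line_poly_mult_eq_0[OF inf line_poly_corner_minor[OF N] _ _ rigid])
    then show ?thesis by simp
  qed
  \<comment> \<open>As \<open>y x\<close> is a multiple of \<open>x\<close> for every \<open>x\<close>, the matrix \<open>q\<close> of \<open>y\<close> is scalar.\<close>
  define q where "q i j = y (\<lambda>l. of_bool (l = j)) i" for i j
  have P_unit: "P (\<lambda>l. of_bool (l = j)) a = z j a" if "j < N" for j a
  proof -
    have "P (\<lambda>l. of_bool (l = j)) a = (\<Sum>l<N. if l = j then z j a else 0)"
      unfolding P_def by (rule sum.cong) auto
    then show ?thesis
      using that by simp
  qed
  have P_add: "P (\<lambda>l. x l + x' l) a = P x a + P x' a" for x x' a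
    by (simp add: P_def algebra_simps sum.distrib)
  have y_add: "y (\<lambda>l. x l + x' l) i = y x i + y x' i" for x x' i
    by (simp add: y_def P_add algebra_simps sum.distrib)
  define c0 where "c0 = q p p"
  have q_eq: "q i j = c0 * of_bool (i = j)" if i: "i < N" and j: "j < N" for i j
  proof (cases "j = p")
    case True
    then show ?thesis
      using collinear[OF i, of "\<lambda>l. of_bool (l = p)"] by (auto simp: q_def c0_def)
  next
    case False
    have qp: "q i p = c0 * of_bool (i = p)"
      using collinear[OF i, of "\<lambda>l. of_bool (l = p)"] by (auto simp: q_def c0_def)
    have pj: "q p j = 0"
      using collinear[OF j, of "\<lambda>l. of_bool (l = j)"] False by (auto simp: q_def)
    have "q i p + q i j = (c0 + q p j) * (of_bool (i = p) + of_bool (i = j))"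
      using collinear[OF i, of "\<lambda>l. of_bool (l = p) + of_bool (l = j)"] False
      by (simp add: y_add q_def c0_def)
    then show ?thesis
      using qp pj by (simp add: algebra_simps)
  qed
  have z_eq: "z j a = c0 * g $$ (j, a)" if j: "j < N" and a: "a < N" for j a
  proof -
    have "z j a = (\<Sum>i<N. q i j * g $$ (i, a))"
      using y_g[OF a, of "\<lambda>l. of_bool (l = j)"] P_unit[OF j] by (simp add: q_def)
    also have "\<dots> = (\<Sum>i<N. if i = j then c0 * g $$ (j, a) else 0)"
      using j by (intro sum.cong refl) (auto simp: q_eq)
    finally show ?thesis
      using j by simp
  qed
  have "\<exists>r<N. \<exists>s<N. g $$ (r, s) \<noteq> 0"
  proof (rule ccontr)
    assume "\<not> ?thesis"
    then have "(\<Sum>i<N. g $$ (0, i) * g' $$ (i, 0)) = 0"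
      using N by (intro sum.neutral) auto
    then show False
      using gg'[of 0 0] N by simp
  qed
  then obtain r s where rs: "r < N" "s < N" "g $$ (r, s) \<noteq> 0"
    by blast
  define t where "t = g $$ (r, s)"
  define G where "G i a = g $$ (i, a) / t" for i a
  define H where "H b k = h' $$ (b, k) * c0 * t * t" for b k
  have "skew T' k i j = tensor_action N G H T k i j" if k: "k < N" and i: "i < N" and j: "j < N" for k i j
  proof -
    have "skew T' k i j =
        (\<Sum>a<N. \<Sum>b<N. \<Sum>l<N. g $$ (i, a) * (skew T b a l * (c0 * g $$ (j, l))) * h' $$ (b, k))"
      unfolding z[OF j i k] col_form_def
      by (intro sum.cong refl) (simp add: sum_distrib_left sum_distrib_right z_eq j)
    also have "\<dots> = tensor_action N G H T k i j"
      unfolding tensor_action_def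
      by (intro sum.cong refl) (use rs(3) in \<open>simp add: G_def H_def t_def\<close>)
    finally show ?thesis .
  qed
  moreover have "G r s = 1"
    using rs(3) by (simp add: G_def t_def)
  ultimately show ?thesis
    using rs(1,2) by blast
qed

section \<open>Orbits are contained in hypersurfaces\<close>

text \<open>The independent coordinates of the alternating matrices, as triples \<open>(k, j, i)\<close> with \<open>i < j\<close>.\<close>

definition tensor_coords :: "nat \<Rightarrow> (nat \<times> nat \<times> nat) set" where
  "tensor_coords N = {..<N} \<times> (SIGMA j:{..<N}. {..<j})"

lemma finite_tensor_coords: "finite (tensor_coords N)"
  by (simp add: tensor_coords_def)

text \<open>The cardinality is \<open>N * (N * (N - 1) div 2)\<close>, and this is where \<open>N \<ge> 5\<close> is needed: the tensors
  equivalent to a given one are parametrised by \<open>2 * (N * N) - 1\<close> scalars.\<close>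

lemma card_tensor_coords:
  assumes "N \<ge> 5"
  shows "2 * (N * N) \<le> card (tensor_coords N)"
proof -
  have "2 * (\<Sum>j<N. j) = N * (N - 1)"
    by (induction N) (auto simp: algebra_simps)
  moreover have "N * 4 \<le> N * (N - 1)"
    using assms by (intro mult_le_mono2) simp
  ultimately have "2 * N \<le> (\<Sum>j<N. j)"
    by linarith
  then have "N * (2 * N) \<le> N * (\<Sum>j<N. j)"
    by (rule mult_le_mono2)
  then show ?thesis
    by (simp add: tensor_coords_def card_cartesian_product algebra_simps)
qed

text \<open>The tensors that arise from \<open>T\<close> by matrices with \<open>G r s = 1\<close> lie in the zero set of a nonzero
  function.\<close>

lemma orbit_hypersurface:
  fixes T :: "nat \<times> nat \<times> nat \<Rightarrow> 'k::field"
  assumes inf: "infinite (UNIV :: 'k set)" and N: "N \<ge> 5" and rs: "r < N" "s < N"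
  shows "\<exists>F :: (nat \<times> nat \<times> nat \<Rightarrow> 'k) \<Rightarrow> 'k. line_poly F \<and> (\<exists>T'. F T' \<noteq> 0) \<and>
    (\<forall>T' G H. G r s = 1 \<longrightarrow>
      (\<forall>k<N. \<forall>i<N. \<forall>j<N. skew T' k i j = tensor_action N G H T k i j) \<longrightarrow> F T' = 0)"
proof -
  \<comment> \<open>The entries of \<open>G\<close> and \<open>H\<close> are the variables with first index \<open>0\<close> and \<open>1\<close>.\<close>
  define \<phi> where "\<phi> y = (\<lambda>(k, j, i).
      tensor_action N (\<lambda>i a. y (0, i, a)) (\<lambda>b k. y (1, b, k)) T k i j)" for y :: "nat \<times> nat \<times> nat \<Rightarrow> 'k"
  define I :: "(nat \<times> nat \<times> nat) set" where "I = {..<2} \<times> {..<N} \<times> {..<N} - {(0, r, s)}"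
  have "card I < 2 * (N * N)"
  proof -
    have "(0, r, s) \<in> {..<2 :: nat} \<times> {..<N} \<times> {..<N}"
      using rs by simp
    then have "card I = card ({..<2 :: nat} \<times> {..<N} \<times> {..<N}) - 1"
      unfolding I_def by (rule card_Diff_singleton)
    then show ?thesis
      using N by (simp add: card_cartesian_product)
  qed
  then have card: "card I < card (tensor_coords N)"
    using card_tensor_coords[OF N] by linarith
  \<comment> \<open>Each coordinate is cubic: two entries of \<open>G\<close>, one of \<open>H\<close>, and a constant from \<open>T\<close>.\<close>
  have deg: "sep_degree_le I (1 + 1 + 1 + 0) (\<lambda>y. \<phi> y e)" for e
    unfolding \<phi>_def tensor_action_def case_prod_beta
    by (intro sep_degree_le_sum sep_degree_le_mult sep_degree_le_coord sep_degree_le_const)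
  have "finite I"
    by (simp add: I_def)
  from algebraic_dependence[where \<phi> = \<phi> and ?y0.0 = "\<lambda>_. 1",
      OF inf this finite_tensor_coords card deg]
  obtain E a where
    nz: "\<exists>z. (\<Sum>e\<in>E. a e * (\<Prod>c\<in>tensor_coords N. z c ^ e c)) \<noteq> (0 :: 'k)"
    and zero: "\<forall>y. (\<forall>c. c \<notin> I \<longrightarrow> y c = 1) \<longrightarrow>
      (\<Sum>e\<in>E. a e * (\<Prod>c\<in>tensor_coords N. \<phi> y c ^ e c)) = 0"
    by (elim exE conjE) (rule that, rule exI, assumption+)
  define F where "F T' = (\<Sum>e\<in>E. a e *
      (\<Prod>c\<in>tensor_coords N. (case c of (k, j, i) \<Rightarrow> skew T' k i j) ^ e c))" for T'
  have "line_poly F"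
    unfolding line_poly_def F_def skew_def case_prod_beta by (intro allI poly_fun_intros)
  moreover have "\<exists>T'. F T' \<noteq> 0"
  proof -
    obtain z where z: "(\<Sum>e\<in>E. a e * (\<Prod>c\<in>tensor_coords N. z c ^ e c)) \<noteq> 0"
      using nz by blast
    define T' where "T' = (\<lambda>(k, i, j). if i < j then z (k, j, i) else 0)"
    have "(case c of (k, j, i) \<Rightarrow> skew T' k i j) = z c" if "c \<in> tensor_coords N" for c
      using that by (auto simp: tensor_coords_def skew_def T'_def)
    then have "F T' = (\<Sum>e\<in>E. a e * (\<Prod>c\<in>tensor_coords N. z c ^ e c))"
      unfolding F_def by (simp cong: prod.cong)
    then show ?thesis
      using z by metis
  qed
  moreover have "F T' = 0"
    if "G r s = 1" and act: "\<forall>k<N. \<forall>i<N. \<forall>j<N. skew T' k i j = tensor_action N G H T k i j" for T' G H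
  proof -
    define y where "y = (\<lambda>c. if c \<in> I then (case c of (m, i, j) \<Rightarrow> if m = 0 then G i j else H i j) else 1)"
    have yG: "y (0, i, j) = G i j" if "i < N" "j < N" for i j
      using that \<open>G r s = 1\<close> by (auto simp: y_def I_def)
    have yH: "y (1, i, j) = H i j" if "i < N" "j < N" for i j
      using that by (auto simp: y_def I_def)
    have "(case c of (k, j, i) \<Rightarrow> skew T' k i j) = \<phi> y c" if c: "c \<in> tensor_coords N" for c
    proof -
      obtain k j i where c_eq: "c = (k, j, i)"
        by (cases c)
      then have "k < N" "j < N" "i < N"
        using c by (auto simp: tensor_coords_def)
      moreover from this have "\<phi> y c = tensor_action N G H T k i j"
        unfolding \<phi>_def c_eq tensor_action_def case_prod_conv
        by (intro sum.cong refl) (simp add: yG yH[unfolded One_nat_def])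
      ultimately show ?thesis
        using act c_eq by simp
    qed
    then have "F T' = (\<Sum>e\<in>E. a e * (\<Prod>c\<in>tensor_coords N. \<phi> y c ^ e c))"
      unfolding F_def by (simp cong: prod.cong)
    also have "\<dots> = 0"
      using zero[rule_format, of y] by (simp add: y_def)
    finally show ?thesis .
  qed
  ultimately show ?thesis
    by blast
qed

lemma conjugacy_class_hypersurfaces:
  fixes T :: "nat \<times> nat \<times> nat \<Rightarrow> 'k::field"
  assumes inf: "infinite (UNIV :: 'k set)" and N: "N \<ge> 5"
  shows "\<exists>\<F>. finite \<F> \<and> (\<forall>F\<in>\<F>. line_poly F \<and> (\<exists>T'. F T' \<noteq> 0)) \<and>
    (\<forall>T'. corner_minor N T' (\<lambda>_. 1) \<noteq> 0 \<longrightarrow>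
      conjugate_matrix_spaces N (skew_space N T) (skew_space N T') \<longrightarrow> (\<exists>F\<in>\<F>. F T' = 0))"
proof -
  obtain F where F: "\<And>r s. r < N \<Longrightarrow> s < N \<Longrightarrow> line_poly (F r s) \<and> (\<exists>T'. F r s T' \<noteq> 0) \<and>
      (\<forall>T' G H. G r s = 1 \<longrightarrow>
        (\<forall>k<N. \<forall>i<N. \<forall>j<N. skew T' k i j = tensor_action N G H T k i j) \<longrightarrow> F r s T' = 0)"
    using orbit_hypersurface[OF inf N, of _ _ T] by metis
  define \<F> where "\<F> = (\<lambda>(r, s). F r s) ` ({..<N} \<times> {..<N})"
  have "finite \<F>"
    by (simp add: \<F>_def)
  moreover have "\<forall>F\<in>\<F>. line_poly F \<and> (\<exists>T'. F T' \<noteq> 0)"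
    using F by (auto simp: \<F>_def)
  moreover have "\<exists>F\<in>\<F>. F T' = 0"
    if rigid: "corner_minor N T' (\<lambda>_. 1) \<noteq> 0"
      and conj: "conjugate_matrix_spaces N (skew_space N T) (skew_space N T')" for T'
  proof -
    have "N > 0"
      using N by simp
    from conjugate_skew_spaces[OF inf this conj rigid]
    obtain G H r s where "r < N" "s < N" "G r s = 1"
      "\<forall>k<N. \<forall>i<N. \<forall>j<N. skew T' k i j = tensor_action N G H T k i j"
      by blast
    then have "F r s T' = 0" and "F r s \<in> \<F>"
      using F[of r s] by (blast, auto simp: \<F>_def)
    then show ?thesis
      by blast
  qed
  ultimately show ?thesis
    by blast
qed

section \<open>Infinitely many conjugacy classes\<close>

theorem theorem3p4:
  fixes N :: nat
  assumes "infinite (UNIV :: 'k::field set)"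
    and "CHAR('k) \<noteq> 2"
    and "N \<ge> 5"
  shows "infinite ({\<A> :: 'k mat set. maximal_singular_matrix_space N \<A>} // conjugacy_rel N)"
proof
  assume fin: "finite ({\<A> :: 'k mat set. maximal_singular_matrix_space N \<A>} // conjugacy_rel N)"
  note inf = assms(1)
  have N: "N > 0" "N \<ge> 2" "N \<ge> 3"
    using assms(3) by auto
  let ?C = "cyclic_tensor N :: _ \<Rightarrow> 'k"
  obtain \<alpha> where \<alpha>: "\<And>a. a < N * N \<Longrightarrow> \<alpha> a \<in> functional_indices N"
    and full: "det (sq_mat (N * N) (\<lambda>a m. functional N ?C (\<alpha> a) (m div N) (m mod N))) \<noteq> 0"
    using cyclic_functionals_full[OF inf N(3)] by blast
  define D1 where "D1 T = det (sq_mat N (\<lambda>i j. skew T i i j))" for T :: "nat \<times> nat \<times> nat \<Rightarrow> 'k"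
  define D2 where "D2 T = det (sq_mat (N * N) (\<lambda>a m. functional N T (\<alpha> a) (m div N) (m mod N)))" for T
  define D3 where "D3 T = corner_minor N T (\<lambda>_. 1)" for T :: "nat \<times> nat \<times> nat \<Rightarrow> 'k"
  have lp: "line_poly D1" "line_poly D2" "line_poly D3"
  proof -
    show "line_poly D1"
      unfolding line_poly_def D1_def skew_def by (intro allI poly_fun_det poly_fun_intros)
    have "poly_fun (\<lambda>t. functional N (\<lambda>j. u j + t * v j) (\<alpha> a) (m div N) (m mod N))"
      if am: "a < N * N" "m < N * N" for u v a m
    proof (cases "\<alpha> a")
      case (Inl b)
      then obtain x p q where "\<alpha> a = Inl (x, p, q)" "p < N" "q < N"
        using \<alpha>[OF am(1)] by (auto simp: functional_indices_def)
      moreover have "m div N < N" "m mod N < N"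
        using am N by (auto simp: less_mult_imp_div_less)
      ultimately show ?thesis
        by (auto simp: col_form_def skew_def intro!: poly_fun_intros poly_fun_adj_entry)
    qed (simp add: poly_fun_const)
    then show "line_poly D2"
      unfolding line_poly_def D2_def by (intro allI poly_fun_det)
    show "line_poly D3"
      unfolding line_poly_def D3_def corner_minor_def col_form_def skew_def
      using N by (intro allI poly_fun_adj_entry poly_fun_intros) auto
  qed
  have "D1 ?C \<noteq> 0" "D2 ?C \<noteq> 0" "D3 ?C \<noteq> 0"
    using cyclic_diag_det[OF N(2)] full cyclic_adj_entry_nonzero[OF N(1), of "\<lambda>_. 1 :: 'k"]
    by (simp_all add: D1_def D2_def D3_def corner_minor_def)
  then have nz: "\<exists>T. D1 T \<noteq> 0" "\<exists>T. D2 T \<noteq> 0" "\<exists>T. D3 T \<noteq> 0"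
    by blast+
  \<comment> \<open>If there were finitely many classes, finitely many representatives would account for all
    tensors in the nonempty open set \<open>Good\<close>, which would be covered by finitely many
    hypersurfaces.\<close>
  define Good where "Good = {T. D1 T \<noteq> 0 \<and> D2 T \<noteq> 0 \<and> D3 T \<noteq> 0}"
  have max: "maximal_singular_matrix_space N (skew_space N T)" if "T \<in> Good" for T
    using that by (intro maximal_skew_space[OF inf N(1) _ \<alpha>]) (auto simp: Good_def D1_def D2_def)
  define cls where "cls T = conjugacy_rel N `` {skew_space N T}" for T :: "nat \<times> nat \<times> nat \<Rightarrow> 'k"
  have "cls ` Good \<subseteq> {\<A> :: 'k mat set. maximal_singular_matrix_space N \<A>} // conjugacy_rel N"
    using max by (auto simp: cls_def intro!: quotientI)
  then have "finite (cls ` Good)"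
    using fin finite_subset by blast
  then obtain R where R: "R \<subseteq> Good" "finite R" "cls ` Good = cls ` R"
    using finite_subset_image[of "cls ` Good" cls Good] by blast
  obtain \<F> where \<F>: "\<And>T :: nat \<times> nat \<times> nat \<Rightarrow> 'k. finite (\<F> T)"
    "\<And>T F. F \<in> \<F> T \<Longrightarrow> line_poly F \<and> (\<exists>T'. F T' \<noteq> 0)"
    "\<And>T T'. D3 T' \<noteq> 0 \<Longrightarrow> conjugate_matrix_spaces N (skew_space N T) (skew_space N T') \<Longrightarrow>
      \<exists>F\<in>\<F> T. F T' = 0"
    using conjugacy_class_hypersurfaces[OF inf assms(3)] unfolding D3_def by metis
  have "\<exists>T. \<forall>F\<in>{D1, D2, D3} \<union> (\<Union>T\<in>R. \<F> T). F T \<noteq> 0"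
    using lp nz \<F>(1,2) R(2) by (intro line_poly_common_nonzero[OF inf]) auto
  then obtain T where T: "T \<in> Good" and avoid: "\<And>S F. S \<in> R \<Longrightarrow> F \<in> \<F> S \<Longrightarrow> F T \<noteq> 0"
    by (auto simp: Good_def)
  obtain S where S: "S \<in> R" "cls T = cls S"
    using T R(3) by (metis image_iff)
  have "(skew_space N T, skew_space N T) \<in> conjugacy_rel N"
    using singular_skew_space[OF N(1), of T]
    by (auto simp: conjugacy_rel_def singular_matrix_space_iff intro!: conjugate_matrix_spaces_refl)
  then have "skew_space N T \<in> cls S"
    unfolding S(2)[symmetric] by (simp add: cls_def)
  then have "conjugate_matrix_spaces N (skew_space N S) (skew_space N T)"
    by (auto simp: cls_def conjugacy_rel_def)
  then obtain F where "F \<in> \<F> S" "F T = 0"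
    using \<F>(3)[of T S] T by (auto simp: Good_def)
  then show False
    using avoid S(1) by blast
qed

end
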